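(* For every integer $k \geq 2$ there exist constants $A > 0$ and $t \in \mathbb{N}$, depending only on $k$, such that the following holds. Let $G = \mathbb{F}_2^n$ for some $n$, let $r$ be a non-negative integer, and let $\alpha \colon G^k \to \mathbb{F}_2$ be a multilinear form with $\operatorname{prank}(\alpha + \alpha \circ (1\,\,2)) \leq r$. Then there exists a multilinear form $\alpha' \colon G^k \to \mathbb{F}_2$ which is symmetric in the first $2$ variables and satisfies $\operatorname{prank}(\alpha + \alpha') \leq \exp^{(t)}(Ar)$.
   Context: For a permutation $\pi \in \operatorname{Sym}_k$ and a multilinear form $\alpha \colon G^k \to \mathbb{F}_2$, $\alpha\circ\pi$ is the multilinear form $(x_1,\dots,x_k) \mapsto \alpha(x_{\pi^{-1}(1)}, \dots, x_{\pi^{-1}(k)})$; in particular $\alpha \circ (1\,\,2)(x_1,x_2,x_3,\dots,x_k) = \alpha(x_2,x_1,x_3,\dots,x_k)$. A form is symmetric in a set of variables if it is invariant under all permutations of those variables. $\exp^{(t)}$ denotes the $t$-fold composition of the exponential function. The partition rank $\operatorname{prank}\alpha$ of a multilinear form $\alpha \colon G^k \to \mathbb{F}_2$ is the least non-negative integer $m$ such that \[\alpha(x_1,\dots,x_k) = \sum_{i=1}^m \beta_i(x_j : j \in I_i)\,\gamma_i(x_j : j \in [k]\setminus I_i)\] for some sets $\emptyset \neq I_i \subsetneq [k]$ and multilinear forms $\beta_i \colon G^{I_i} \to \mathbb{F}_2$, $\gamma_i \colon G^{[k]\setminus I_i} \to \mathbb{F}_2$. *)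

theory Defs
  imports
    Complex_Main
    "HOL-Library.Z2"
    "HOL-Library.FuncSet"
    "HOL-Combinatorics.Permutations"
    "Jordan_Normal_Form.Matrix"
begin

text \<open>
  Vectors of dimension \<open>n\<close> over the two-element field \<^typ>\<open>bit\<close> are the elements of
  \<open>carrier_vec n\<close>, so that \<open>n\<close> can be quantified inside a formula. A tuple indexed by a set
  \<open>I\<close> is an extensional function on \<open>I\<close>. A form is a HOL function of which only the values
  on \<open>tuples n I\<close> are ever relevant.
\<close>

type_synonym form = "(nat \<Rightarrow> bit vec) \<Rightarrow> bit"

definition tuples :: "nat \<Rightarrow> nat set \<Rightarrow> (nat \<Rightarrow> bit vec) set" where
  "tuples n I = (I \<rightarrow>\<^sub>E carrier_vec n)"

definition multilinear_form :: "nat \<Rightarrow> nat set \<Rightarrow> form \<Rightarrow> bool" where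
  "multilinear_form n I f \<longleftrightarrow>
    (\<forall>x\<in>tuples n I. \<forall>i\<in>I. \<forall>u\<in>carrier_vec n.
      (\<forall>v\<in>carrier_vec n. f (x(i := u + v)) = f (x(i := u)) + f (x(i := v))) \<and>
      (\<forall>c. f (x(i := c \<cdot>\<^sub>v u)) = c * f (x(i := u))))"

definition permute_form :: "form \<Rightarrow> (nat \<Rightarrow> nat) \<Rightarrow> form" where
  "permute_form f \<pi> = (\<lambda>x. f (\<lambda>i. x (inv_into UNIV \<pi> i)))"

definition symmetric_in :: "nat \<Rightarrow> nat \<Rightarrow> nat set \<Rightarrow> form \<Rightarrow> bool" where
  "symmetric_in n k S f \<longleftrightarrow>
    (\<forall>\<pi>. \<pi> permutes S \<longrightarrow> (\<forall>x\<in>tuples n {1..k}. permute_form f \<pi> x = f x))"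

definition partition_decomposition :: "nat \<Rightarrow> nat \<Rightarrow> form \<Rightarrow> nat \<Rightarrow> bool" where
  "partition_decomposition n k f m \<longleftrightarrow>
    (\<exists>(I :: nat \<Rightarrow> nat set) (\<beta> :: nat \<Rightarrow> form) (\<gamma> :: nat \<Rightarrow> form).
      (\<forall>i\<in>{1..m}. I i \<noteq> {} \<and> I i \<subset> {1..k} \<and>
        multilinear_form n (I i) (\<beta> i) \<and> multilinear_form n ({1..k} - I i) (\<gamma> i)) \<and>
      (\<forall>x\<in>tuples n {1..k}.
        f x = (\<Sum>i=1..m. \<beta> i (restrict x (I i)) * \<gamma> i (restrict x ({1..k} - I i)))))"

text \<open>
  For \<open>k \<ge> 2\<close> every multilinear form has a decomposition (expand in the coordinates of the
  first variable), so the minimum exists. For \<open>k = 1\<close> a nonzero form has none, and the value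
  is then unspecified.
\<close>

definition prank :: "nat \<Rightarrow> nat \<Rightarrow> form \<Rightarrow> nat" where
  "prank n k f = (LEAST m. partition_decomposition n k f m)"

end

theory Submission
  imports Defs "HOL-Library.Function_Algebras" "HOL-Library.Nat_Bijection"
begin

text \<open>
  Write \<open>sw\<close> for the exchange of the first two variables and \<open>\<phi> = \<alpha> + sw \<alpha>\<close>. It suffices to find
  \<open>\<psi>\<close> of low partition rank with \<open>\<phi> = \<psi> + sw \<psi>\<close>, because then \<open>\<alpha> + \<psi>\<close> is symmetric. This works
  with a polynomial bound. The basic device: if \<open>F(y, x) = \<Sum>\<^sub>i \<beta>\<^sub>i(y) g\<^sub>i(x)\<close> has \<open>N\<close> terms, then
  \<open>F(y, x) = \<Sum>\<^sub>j F(y, p\<^sub>j) h\<^sub>j(x)\<close> for at most \<open>N\<close> points \<open>p\<^sub>j\<close> and combinations \<open>h\<^sub>j\<close> of the \<open>g\<^sub>i\<close>.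

  Let \<open>z\<close> be the remaining variables. The terms of \<open>\<phi>\<close> have the shape
  \<open>\<beta>(x\<^sub>1, x\<^sub>2, z\<^sub>I) w\<close> or \<open>\<beta>(x\<^sub>1, z\<^sub>I) \<gamma>(x\<^sub>2, z\<^sub>J) w\<close>, where \<open>w\<close> depends on the other variables.
  Take \<open>I\<close> maximal for a linear order that extends inclusion and let \<open>F\<close> be the sum of the terms
  with this \<open>I\<close>, so that \<open>F(\<cdot>, p)\<close> is the sum of \<open>\<phi>(\<cdot>, p)\<close> and of slices of other terms, which
  factor further because they do not contain \<open>I\<close>. For the first shape, \<open>\<phi>(\<cdot>, p)\<close> is again of the form
  \<open>b + sw b\<close>. For the second one, modulo \<open>\<psi> + sw \<psi>\<close> one may assume \<open>J < I\<close> in the order,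
  and then \<open>\<phi>(\<cdot>, p) = (sw \<phi>)(\<cdot>, p)\<close> factors further as well. When only \<open>I = {}\<close> is left,
  symplectic Gram-Schmidt finishes the proof.
\<close>

section \<open>Sums of boundedly many elements of a set\<close>

text \<open>Lists allow repeated terms, and \<open>N\<close> is only an upper bound. With the set
  \<open>PR\<close> of products below, membership in \<open>sums_of N PR\<close> plays the part of
  partition rank at most \<open>N\<close>.\<close>

definition sums_of :: "nat \<Rightarrow> 'a::comm_monoid_add set \<Rightarrow> 'a set" where
  "sums_of N T = {sum_list ts |ts. length ts \<le> N \<and> set ts \<subseteq> T}"

lemma sums_ofI: "length ts \<le> N \<Longrightarrow> set ts \<subseteq> T \<Longrightarrow> sum_list ts \<in> sums_of N T"
  by (auto simp: sums_of_def)

lemma sums_ofE: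
  assumes "f \<in> sums_of N T"
  obtains ts where "f = sum_list ts" "length ts \<le> N" "set ts \<subseteq> T"
  using assms by (auto simp: sums_of_def)

lemma sums_of_zero: "0 \<in> sums_of N T"
  using sums_ofI[of "[]"] by simp

lemma sums_of_single: "t \<in> T \<Longrightarrow> t \<in> sums_of 1 T"
  using sums_ofI[of "[t]"] by simp

lemma sums_of_mono: "f \<in> sums_of N T \<Longrightarrow> N \<le> M \<Longrightarrow> T \<subseteq> U \<Longrightarrow> f \<in> sums_of M U"
  by (fastforce simp: sums_of_def)

lemma sums_of_add: "f \<in> sums_of N T \<Longrightarrow> g \<in> sums_of M T \<Longrightarrow> f + g \<in> sums_of (N + M) T"
proof (elim sums_ofE)
  fix ts us
  assume "f = sum_list ts" "length ts \<le> N" "set ts \<subseteq> T"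
    "g = sum_list us" "length us \<le> M" "set us \<subseteq> T"
  then show ?thesis using sums_ofI[of "ts @ us" "N + M" T] by simp
qed

lemma sums_of_setsum:
  assumes "finite J" "card J \<le> N" "\<And>j. j \<in> J \<Longrightarrow> f j \<in> T"
  shows "sum f J \<in> sums_of N T"
proof -
  obtain js where "distinct js" "set js = J"
    using finite_distinct_list[OF assms(1)] by blast
  then have "sum f J = sum_list (map f js)" "length js = card J"
    by (auto simp: sum_list_distinct_conv_sum_set distinct_card)
  then show ?thesis using assms \<open>set js = J\<close> sums_ofI[of "map f js" N T] by auto
qed

lemma sums_of_sum:
  "(\<And>j. j < M \<Longrightarrow> f j \<in> sums_of N T) \<Longrightarrow> (\<Sum>j<M. f j) \<in> sums_of (M * N) T"
proof (induction M)
  case (Suc M)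
  then have "(\<Sum>j<M. f j) + f M \<in> sums_of (M * N + N) T" by (intro sums_of_add) auto
  then show ?case by (simp add: add.commute)
qed (simp add: sums_of_zero)

lemma sums_of_image:
  assumes "f \<in> sums_of N T" "L 0 = 0" "\<And>x y. L (x + y) = L x + L y"
    and T: "\<And>t. t \<in> T \<Longrightarrow> L t \<in> U"
  shows "L f \<in> sums_of N U"
proof -
  obtain ts where ts: "f = sum_list ts" "length ts \<le> N" "set ts \<subseteq> T"
    using assms(1) by (rule sums_ofE)
  have "L (sum_list ts) = sum_list (map L ts)" by (induction ts) (auto simp: assms)
  then show ?thesis using ts T sums_ofI[of "map L ts" N U] by auto
qed

lemma sums_of_mult:
  fixes f :: "'a::comm_ring"
  assumes f: "f \<in> sums_of N S" and g: "g \<in> sums_of M T"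
    and U: "\<And>s t. s \<in> S \<Longrightarrow> t \<in> T \<Longrightarrow> s * t \<in> U"
  shows "f * g \<in> sums_of (N * M) U"
proof -
  obtain ts where ts: "f = sum_list ts" "length ts \<le> N" "set ts \<subseteq> S"
    using f by (rule sums_ofE)
  have "sum_list ts * g \<in> sums_of (length ts * M) U" if "set ts \<subseteq> S"
    using that
  proof (induction ts)
    case Nil then show ?case by (simp add: sums_of_zero)
  next
    case (Cons s ts)
    have "s * g \<in> sums_of M U"
      by (rule sums_of_image[OF g]) (use Cons.prems U in \<open>auto simp: distrib_left\<close>)
    moreover have "sum_list ts * g \<in> sums_of (length ts * M) U" using Cons by auto
    ultimately have "s * g + sum_list ts * g \<in> sums_of (M + length ts * M) U"
      by (rule sums_of_add)
    then show ?case by (simp add: distrib_right)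
  qed
  then show ?thesis using ts by (auto intro: sums_of_mono)
qed

lemma sums_of_split:
  assumes "f \<in> sums_of N (S \<union> T)"
  obtains g h where "g \<in> sums_of N S" "h \<in> sums_of N T" "f = g + h"
proof -
  obtain ts where ts: "f = sum_list ts" "length ts \<le> N" "set ts \<subseteq> S \<union> T"
    using assms by (rule sums_ofE)
  let ?l = "filter (\<lambda>t. t \<in> S) ts" and ?r = "filter (\<lambda>t. t \<notin> S) ts"
  have "sum_list ts = sum_list ?l + sum_list ?r"
    by (induction ts) (auto simp: ac_simps)
  moreover have "length ?l \<le> N" "length ?r \<le> N"
    using ts(2) by (auto intro: order_trans[OF length_filter_le])
  moreover have "set ?l \<subseteq> S" "set ?r \<subseteq> T" using ts(3) by auto
  ultimately show ?thesis
    using that[OF sums_ofI[of ?l] sums_ofI[of ?r]] ts(1) by simp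
qed

text \<open>Termwise rewriting modulo the image of an additive map. It is used with
  \<open>L = sym_sum\<close>, to change the terms of \<phi> modulo forms \<psi> + \<open>sw\<close>
  \<psi>.\<close>

lemma sums_of_replace:
  assumes "f \<in> sums_of N T"
    and "\<And>t. t \<in> T \<Longrightarrow> \<exists>u g. u \<in> U \<and> g \<in> G \<and> t = u + L g"
    and L: "L 0 = 0" "\<And>x y. L (x + y) = L x + L y"
  obtains u g where "u \<in> sums_of N U" "g \<in> sums_of N G" "f = u + L g"
proof -
  obtain ts where ts: "f = sum_list ts" "length ts \<le> N" "set ts \<subseteq> T"
    using assms(1) by (rule sums_ofE)
  obtain u g where ug: "\<And>t. t \<in> T \<Longrightarrow> u t \<in> U \<and> g t \<in> G \<and> t = u t + L (g t)"
    using assms(2) by metis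
  have "sum_list ts = sum_list (map u ts) + L (sum_list (map g ts))" if "set ts \<subseteq> T"
    using that
  proof (induction ts)
    case (Cons t ts)
    then show ?case using ug[of t] by (simp add: L ac_simps) (metis add.left_commute add.assoc)
  qed (simp add: L)
  moreover have "set (map u ts) \<subseteq> U" "set (map g ts) \<subseteq> G" using ts(3) ug by auto
  ultimately show ?thesis
    using that[OF sums_ofI[of "map u ts"] sums_ofI[of "map g ts"]] ts by simp
qed

section \<open>Rank factorisation through sections\<close>

text \<open>Gaussian elimination on the functions \<open>g i\<close>, with a point where one of them
  is nonzero as pivot. The first factor on the right is the section at \<open>p i\<close> of the
  whole sum, so that facts about the sum can be used for each factor.\<close>

lemma section_factorisation:
  fixes \<beta> :: "'i \<Rightarrow> 'y \<Rightarrow> 'f::field" and g :: "'i \<Rightarrow> 'x \<Rightarrow> 'f"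
  assumes "finite I"
  shows "\<exists>p c. \<forall>y x. (\<Sum>i\<in>I. \<beta> i y * g i x) =
    (\<Sum>i\<in>I. (\<Sum>j\<in>I. \<beta> j y * g j (p i)) * (\<Sum>j\<in>I. c i j * g j x))"
  using assms
proof (induction I arbitrary: g rule: finite_induct)
  case empty
  then show ?case by simp
next
  case (insert a I)
  show ?case
  proof (cases "\<forall>x. g a x = 0")
    case True
    obtain p c where pc: "\<And>y x. (\<Sum>i\<in>I. \<beta> i y * g i x) =
      (\<Sum>i\<in>I. (\<Sum>j\<in>I. \<beta> j y * g j (p i)) * (\<Sum>j\<in>I. c i j * g j x))"
      using insert.IH[of g] by blast
    \<comment> \<open>The row of \<open>a\<close> is zero, so its term vanishes whatever point
      \<open>p a\<close> is.\<close>
    define c' where "c' i j = (if i = a then 0 else c i j)" for i j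
    have "(\<Sum>i\<in>I. (\<Sum>j\<in>I. \<beta> j y * g j (p i)) * (\<Sum>j\<in>I. c' i j * g j x)) =
       (\<Sum>i\<in>I. (\<Sum>j\<in>I. \<beta> j y * g j (p i)) * (\<Sum>j\<in>I. c i j * g j x))" for x y
    proof (intro sum.cong refl)
      fix i assume "i \<in> I"
      then have "i \<noteq> a" using insert.hyps by auto
      then show "(\<Sum>j\<in>I. \<beta> j y * g j (p i)) * (\<Sum>j\<in>I. c' i j * g j x) =
        (\<Sum>j\<in>I. \<beta> j y * g j (p i)) * (\<Sum>j\<in>I. c i j * g j x)" by (simp add: c'_def)
    qed
    then have "(\<Sum>i\<in>insert a I. \<beta> i y * g i x) = (\<Sum>i\<in>insert a I.
        (\<Sum>j\<in>insert a I. \<beta> j y * g j (p i)) * (\<Sum>j\<in>insert a I. c' i j * g j x))" for x y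
      using insert.hyps True pc[of y x] by (simp add: c'_def[of a])
    then show ?thesis by blast
  next
    case False
    then obtain e where e: "g a e \<noteq> 0" by blast
    \<comment> \<open>The new functions vanish at the pivot \<open>e\<close>. On the level of sums
      this subtracts the rank-one piece \<open>F y e * g a x / g a e\<close>.\<close>
    define g' where "g' i x = g i x - g i e / g a e * g a x" for i x
    obtain p c where pc: "\<And>y x. (\<Sum>i\<in>I. \<beta> i y * g' i x) =
      (\<Sum>i\<in>I. (\<Sum>j\<in>I. \<beta> j y * g' j (p i)) * (\<Sum>j\<in>I. c i j * g' j x))"
      using insert.IH[of g'] by blast
    define F where "F y x = (\<Sum>j\<in>insert a I. \<beta> j y * g j x)" for x y
    have H: "(\<Sum>i\<in>I. \<beta> i y * g' i x) = F y x - F y e * g a x / g a e" for x y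
      using insert.hyps e
      by (simp add: F_def g'_def algebra_simps sum_subtractf sum_distrib_left
          sum_distrib_right sum_divide_distrib add_divide_distrib)
    define d where "d i = (\<Sum>j\<in>I. c i j * g j e)" for i
    have G: "(\<Sum>j\<in>I. c i j * g' j x) = (\<Sum>j\<in>I. c i j * g j x) - d i / g a e * g a x" for i x
      by (simp add: g'_def d_def algebra_simps sum_subtractf sum_distrib_left
          sum_distrib_right sum_divide_distrib)
    define p' where "p' = p(a := e)"
    define s where "s j = (\<Sum>i\<in>I. g a (p i) / g a e * c i j)" for j
    define sd where "sd = (\<Sum>i\<in>I. g a (p i) / g a e * d i)"
    \<comment> \<open>Row \<open>i\<close> of \<open>I\<close> writes the combination of the
      \<open>g' j\<close> in terms of the \<open>g j\<close>. Row \<open>a\<close> collects the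
      coefficient of \<open>F y e\<close>: it is \<open>g a / g a e\<close> minus the other
      combinations weighted by \<open>g a (p i) / g a e\<close>.\<close>
    define c' where "c' i j = (if i = a then (if j = a then 1 / g a e + sd / g a e else - s j)
       else (if j = a then - d i / g a e else c i j))" for i j
    have c'I: "(\<Sum>j\<in>insert a I. c' i j * g j x) = (\<Sum>j\<in>I. c i j * g' j x)" if "i \<in> I" for i x
    proof -
      have "i \<noteq> a" using that insert.hyps by auto
      moreover have "(\<Sum>j\<in>I. c' i j * g j x) = (\<Sum>j\<in>I. c i j * g j x)"
        using insert.hyps \<open>i \<noteq> a\<close> by (intro sum.cong) (auto simp: c'_def)
      ultimately show ?thesis using insert.hyps by (simp add: G c'_def)
    qed
    have c'a: "(\<Sum>j\<in>insert a I. c' a j * g j x) =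
        g a x / g a e - (\<Sum>i\<in>I. g a (p i) / g a e * (\<Sum>j\<in>I. c i j * g' j x))" for x
    proof -
      have "(\<Sum>j\<in>I. c' a j * g j x) = (\<Sum>j\<in>I. - s j * g j x)"
        using insert.hyps by (intro sum.cong) (auto simp: c'_def)
      also have "\<dots> = - (\<Sum>i\<in>I. g a (p i) / g a e * (\<Sum>j\<in>I. c i j * g j x))"
        unfolding s_def
        by (simp add: sum_distrib_left sum_distrib_right sum_negf mult.assoc) (rule sum.swap)
      finally show ?thesis using insert.hyps
        by (simp add: G c'_def sd_def algebra_simps sum_subtractf sum_distrib_left
          sum_distrib_right sum_divide_distrib add_divide_distrib)
    qed
    have "(\<Sum>i\<in>insert a I. \<beta> i y * g i x) = (\<Sum>i\<in>insert a I.
        (\<Sum>j\<in>insert a I. \<beta> j y * g j (p' i)) * (\<Sum>j\<in>insert a I. c' i j * g j x))" for x y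
    proof -
      have "(\<Sum>i\<in>insert a I. F y (p' i) * (\<Sum>j\<in>insert a I. c' i j * g j x)) =
          F y e * (\<Sum>j\<in>insert a I. c' a j * g j x) +
          (\<Sum>i\<in>I. F y (p i) * (\<Sum>j\<in>I. c i j * g' j x))"
      proof -
        have "(\<Sum>i\<in>I. F y (p' i) * (\<Sum>j\<in>insert a I. c' i j * g j x)) =
          (\<Sum>i\<in>I. F y (p i) * (\<Sum>j\<in>I. c i j * g' j x))"
          using insert.hyps by (intro sum.cong refl) (auto simp: p'_def c'I simp del: sum.insert)
        then show ?thesis using insert.hyps by (subst sum.insert) (auto simp: p'_def)
      qed
      also have "\<dots> = F y e * g a x / g a e +
          (\<Sum>i\<in>I. (F y (p i) - F y e * g a (p i) / g a e) * (\<Sum>j\<in>I. c i j * g' j x))"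
        unfolding c'a
        by (simp add: algebra_simps sum_subtractf sum_distrib_left sum_divide_distrib)
      also have "\<dots> = F y e * g a x / g a e + (\<Sum>i\<in>I. \<beta> i y * g' i x)"
        using pc[of y x] by (simp add: H)
      also have "\<dots> = F y x" by (simp add: H)
      finally show ?thesis unfolding F_def ..
    qed
    then show ?thesis by blast
  qed
qed

section \<open>Multilinear forms over an arbitrary group\<close>

lemma bit_fun_add_self [simp]: "f + f = (0 :: 'a \<Rightarrow> bit)"
  by (simp add: fun_eq_iff)

lemma bit_fun_add_cancel [simp]: "f + (f + g) = (g :: 'a \<Rightarrow> bit)"
  by (simp add: add.assoc[symmetric])

text \<open>Over the two-element field, additivity in each variable is full linearity. The second
  clause lets forms in different sets of variables share one domain, so that their products are
  pointwise.\<close>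

definition mform :: "nat set \<Rightarrow> ((nat \<Rightarrow> 'v::ab_group_add) \<Rightarrow> bit) \<Rightarrow> bool" where
  "mform I f \<longleftrightarrow>
    (\<forall>x. \<forall>i\<in>I. \<forall>u v. f (x(i := u + v)) = f (x(i := u)) + f (x(i := v))) \<and>
    (\<forall>x y. (\<forall>i\<in>I. x i = y i) \<longrightarrow> f x = f y)"

lemma mform_add_at: "mform I f \<Longrightarrow> i \<in> I \<Longrightarrow> f (x(i := u + v)) = f (x(i := u)) + f (x(i := v))"
  by (auto simp: mform_def)

lemma mform_cong: "mform I f \<Longrightarrow> (\<And>i. i \<in> I \<Longrightarrow> x i = y i) \<Longrightarrow> f x = f y"
  by (auto simp: mform_def)

lemma mform_upd: "mform I f \<Longrightarrow> i \<notin> I \<Longrightarrow> f (x(i := u)) = f x"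
  by (rule mform_cong) auto

lemma mform_zero: "mform I 0"
  by (simp add: mform_def)

lemma mform_one: "mform {} 1"
  by (simp add: mform_def)

lemma mform_add:
  assumes "mform I f" "mform I g"
  shows "mform I (f + g)"
  unfolding mform_def
proof (intro conjI ballI allI impI)
  fix x y :: "nat \<Rightarrow> 'a" assume "\<forall>i\<in>I. x i = y i"
  then show "(f + g) x = (f + g) y"
    using mform_cong[OF assms(1), of x y] mform_cong[OF assms(2), of x y] by simp
next
  fix x :: "nat \<Rightarrow> 'a" and i u v
  assume "i \<in> I"
  then show "(f + g) (x(i := u + v)) = (f + g) (x(i := u)) + (f + g) (x(i := v))"
    by (simp only: plus_fun_apply mform_add_at[OF assms(1)] mform_add_at[OF assms(2)] ac_simps)
qed

lemma mform_mult:
  assumes "mform I f" "mform J g" "I \<inter> J = {}"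
  shows "mform (I \<union> J) (f * g)"
  unfolding mform_def
proof (intro conjI ballI allI impI)
  fix x :: "nat \<Rightarrow> 'a" and i u v
  assume "i \<in> I \<union> J"
  then consider "i \<in> I" "i \<notin> J" | "i \<in> J" "i \<notin> I" using assms(3) by auto
  then show "(f * g) (x(i := u + v)) = (f * g) (x(i := u)) + (f * g) (x(i := v))"
    by cases (use assms in \<open>auto simp: mform_add_at mform_upd distrib_left distrib_right\<close>)
next
  fix x y :: "nat \<Rightarrow> 'a" assume "\<forall>i\<in>I \<union> J. x i = y i"
  then show "(f * g) x = (f * g) y"
    using mform_cong[OF assms(1), of x y] mform_cong[OF assms(2), of x y] by simp
qed

lemma mform_mult': "mform I f \<Longrightarrow> mform J g \<Longrightarrow> I \<inter> J = {} \<Longrightarrow> I \<union> J = L \<Longrightarrow> mform L (f * g)"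
  using mform_mult by blast

lemma mform_sums_of:
  assumes "f \<in> sums_of N {g. mform I g}"
  shows "mform I f"
proof -
  obtain ts where ts: "f = sum_list ts" "set ts \<subseteq> {g. mform I g}"
    using assms by (rule sums_ofE)
  then show ?thesis
    by (induction ts arbitrary: f) (auto intro: mform_add mform_zero)
qed

definition slice :: "nat set \<Rightarrow> (nat \<Rightarrow> 'v) \<Rightarrow> ((nat \<Rightarrow> 'v) \<Rightarrow> bit) \<Rightarrow> (nat \<Rightarrow> 'v) \<Rightarrow> bit" where
  "slice A p f x = f (\<lambda>i. if i \<in> A then x i else p i)"

lemma slice_add: "slice A p (f + g) = slice A p f + slice A p g"
  by (simp add: fun_eq_iff slice_def)

lemma slice_mult: "slice A p (f * g) = slice A p f * slice A p g"
  by (simp add: fun_eq_iff slice_def)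

lemma slice_zero: "slice A p 0 = 0"
  by (simp add: fun_eq_iff slice_def)

lemma mform_slice:
  assumes "mform I f"
  shows "mform (I \<inter> A) (slice A p f)"
  unfolding mform_def
proof (intro conjI ballI allI impI)
  fix x :: "nat \<Rightarrow> 'a" and i u v
  assume i: "i \<in> I \<inter> A"
  let ?m = "\<lambda>x i. if i \<in> A then x i else p i"
  have "?m (x(i := w)) = (?m x)(i := w)" for w using i by auto
  then show "slice A p f (x(i := u + v)) = slice A p f (x(i := u)) + slice A p f (x(i := v))"
    using i assms by (simp add: slice_def mform_add_at)
next
  fix x y :: "nat \<Rightarrow> 'a" assume "\<forall>i\<in>I \<inter> A. x i = y i"
  then show "slice A p f x = slice A p f y"
    unfolding slice_def by (intro mform_cong[OF assms]) auto
qed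

lemma mform_slice': "mform I f \<Longrightarrow> I \<inter> A = J \<Longrightarrow> mform J (slice A p f)"
  using mform_slice by blast

text \<open>\<open>section_factorisation\<close> is applied to two independent assignments
  \<open>y\<close> and \<open>x\<close>, which are set equal at the end. The section at
  \<open>q\<close> is \<open>slice A q F\<close> because each \<open>\<beta>\<close> sees only
  \<open>A\<close> and each \<open>g\<close> only variables outside \<open>A\<close>.\<close>

lemma slice_factorisation:
  assumes F: "F \<in> sums_of N {\<beta> * g |\<beta> g. mform A \<beta> \<and> g \<in> G}"
    and G: "\<And>g. g \<in> G \<Longrightarrow> \<exists>B. mform B g \<and> A \<inter> B = {}"
  shows "\<exists>M p h. M \<le> N \<and> (\<forall>j<M. h j \<in> sums_of N G) \<and> F = (\<Sum>j<M. slice A (p j) F * h j)"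
proof -
  obtain ts where ts: "F = sum_list ts" "length ts \<le> N"
      "set ts \<subseteq> {\<beta> * g |\<beta> g. mform A \<beta> \<and> g \<in> G}"
    using F by (rule sums_ofE)
  define M where "M = length ts"
  have "\<exists>\<beta> g. ts ! i = \<beta> * g \<and> mform A \<beta> \<and> g \<in> G" if "i < M" for i
    using ts(3) that nth_mem[of i ts] unfolding M_def by blast
  then obtain \<beta> g where bg: "\<And>i. i < M \<Longrightarrow> ts ! i = \<beta> i * g i \<and> mform A (\<beta> i) \<and> g i \<in> G"
    by metis
  have FS: "F = (\<Sum>i<M. \<beta> i * g i)"
    unfolding ts(1) sum_list_sum_nth M_def[symmetric] by (simp add: bg lessThan_atLeast0)
  have sum_app: "(\<Sum>i\<in>X. f i) x = (\<Sum>i\<in>X. f i x)"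
    for f :: "nat \<Rightarrow> (nat \<Rightarrow> 'a) \<Rightarrow> bit" and X x
    by (induction X rule: infinite_finite_induct) auto
  obtain p c where pc: "\<And>y x. (\<Sum>i<M. \<beta> i y * g i x) =
      (\<Sum>i<M. (\<Sum>j<M. \<beta> j y * g j (p i)) * (\<Sum>j<M. c i j * g j x))"
    using section_factorisation[of "{..<M}" \<beta> g] by blast
  \<comment> \<open>The coefficients are 0 or 1, so a linear combination is a subset sum and has at
    most \<open>N\<close> terms from \<open>G\<close>.\<close>
  define h where "h i = (\<Sum>j | j < M \<and> c i j = 1. g j)" for i
  have h: "h i x = (\<Sum>j<M. c i j * g j x)" for i x
  proof -
    have "h i x = (\<Sum>j | j < M \<and> c i j = 1. g j x)" by (simp add: h_def sum_app)
    also have "\<dots> = (\<Sum>j<M. if c i j = 1 then g j x else 0)"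
      by (subst sum.inter_filter[symmetric]) (auto intro: sum.cong)
    also have "\<dots> = (\<Sum>j<M. c i j * g j x)" by (intro sum.cong) auto
    finally show ?thesis .
  qed
  have slice: "slice A q F y = (\<Sum>j<M. \<beta> j y * g j q)" for q y
  proof -
    let ?m = "\<lambda>i. if i \<in> A then y i else q i"
    have "\<beta> j ?m = \<beta> j y" "g j ?m = g j q" if j: "j < M" for j
    proof -
      show "\<beta> j ?m = \<beta> j y" using bg[OF j] by (intro mform_cong[of A "\<beta> j"]) auto
      obtain B where "mform B (g j)" "A \<inter> B = {}" using bg[OF j] G by blast
      then show "g j ?m = g j q" by (intro mform_cong[of B "g j"]) auto
    qed
    then show ?thesis by (simp add: slice_def FS sum_app)
  qed
  show ?thesis
  proof (intro exI[of _ M] exI[of _ p] exI[of _ h] conjI allI impI)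
    show "M \<le> N" using ts(2) by (simp add: M_def)
    show "h j \<in> sums_of N G" for j
    proof -
      have "card {i. i < M \<and> c j i = 1} \<le> card {..<M}" by (intro card_mono) auto
      then show ?thesis
        unfolding h_def using bg \<open>M \<le> N\<close> by (intro sums_of_setsum) auto
    qed
    show "F = (\<Sum>j<M. slice A (p j) F * h j)"
    proof
      fix x
      have "F x = (\<Sum>i<M. \<beta> i x * g i x)" by (simp add: FS sum_app)
      also have "\<dots> = (\<Sum>j<M. slice A (p j) F x * h j x)"
        unfolding slice h by (rule pc)
      finally show "F x = (\<Sum>j<M. slice A (p j) F * h j) x" by (simp only: sum_app times_fun_apply)
    qed
  qed
qed


section \<open>Forms with two distinguished variables\<close>

text \<open>One constant serves as factor and as exponent. As \<open>c > 0\<close>, the value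
  \<open>b 0\<close> is 0, which settles the case \<open>N = 0\<close> in the closure lemmas and in
  the final bound.\<close>

definition poly_bounded :: "(nat \<Rightarrow> nat) \<Rightarrow> bool" where
  "poly_bounded b \<longleftrightarrow> (\<exists>c>0. \<forall>N. b N \<le> c * N ^ c)"

lemma poly_bounded_id: "poly_bounded (\<lambda>N. N)"
  unfolding poly_bounded_def by (intro exI[of _ 1]) auto

lemma poly_bounded_add:
  assumes "poly_bounded b" "poly_bounded b'"
  shows "poly_bounded (\<lambda>N. b N + b' N)"
proof -
  obtain c d where c: "c > 0" "\<And>N. b N \<le> c * N ^ c" and d: "d > 0" "\<And>N. b' N \<le> d * N ^ d"
    using assms by (auto simp: poly_bounded_def)
  have "b N + b' N \<le> (c + d) * N ^ (c + d)" for N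
  proof (cases "N = 0")
    case False
    have "b N + b' N \<le> c * N ^ c + d * N ^ d" by (rule add_mono[OF c(2) d(2)])
    also have "\<dots> \<le> c * N ^ (c + d) + d * N ^ (c + d)"
      using False by (intro add_mono mult_left_mono power_increasing) auto
    finally show ?thesis by (simp add: distrib_right)
  qed (use c(2)[of 0] d(2)[of 0] c(1) d(1) in \<open>simp add: zero_power\<close>)
  then show ?thesis unfolding poly_bounded_def using c(1) by (intro exI[of _ "c + d"]) auto
qed

lemma poly_bounded_mult:
  assumes "poly_bounded b" "poly_bounded b'"
  shows "poly_bounded (\<lambda>N. b N * b' N)"
proof -
  obtain c d where c: "c > 0" "\<And>N. b N \<le> c * N ^ c" and d: "d > 0" "\<And>N. b' N \<le> d * N ^ d"
    using assms by (auto simp: poly_bounded_def)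
  have "b N * b' N \<le> (c * d + c + d) * N ^ (c * d + c + d)" for N
  proof (cases "N = 0")
    case False
    have "b N * b' N \<le> (c * N ^ c) * (d * N ^ d)" by (rule mult_mono[OF c(2) d(2)]) auto
    also have "\<dots> = (c * d) * N ^ (c + d)" by (simp add: power_add)
    also have "\<dots> \<le> (c * d + c + d) * N ^ (c * d + c + d)"
      using False by (intro mult_mono power_increasing) auto
    finally show ?thesis .
  qed (use c(2)[of 0] c(1) d(1) in \<open>simp add: zero_power\<close>)
  then show ?thesis unfolding poly_bounded_def using c(1)
    by (intro exI[of _ "c * d + c + d"]) auto
qed

lemma poly_bounded_compose:
  assumes "poly_bounded b" "poly_bounded b'"
  shows "poly_bounded (\<lambda>N. b (b' N))"
proof -
  obtain c d where c: "c > 0" "\<And>N. b N \<le> c * N ^ c" and d: "d > 0" "\<And>N. b' N \<le> d * N ^ d"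
    using assms by (auto simp: poly_bounded_def)
  define m where "m = c * d ^ c + d * c"
  have "b (b' N) \<le> m * N ^ m" for N
  proof (cases "N = 0")
    case True
    then show ?thesis using d(2)[of 0] d(1) c(2)[of 0] c(1) by (simp add: zero_power)
  next
    case False
    have "b (b' N) \<le> c * b' N ^ c" by (rule c(2))
    also have "\<dots> \<le> c * (d * N ^ d) ^ c" by (intro mult_left_mono power_mono d(2)) auto
    also have "\<dots> = (c * d ^ c) * N ^ (d * c)" by (simp add: power_mult_distrib power_mult)
    also have "\<dots> \<le> m * N ^ m"
      using False by (intro mult_mono power_increasing) (auto simp: m_def)
    finally show ?thesis .
  qed
  then show ?thesis unfolding poly_bounded_def using c(1) d(1)
    by (intro exI[of _ m]) (auto simp: m_def)
qed

text \<open>Comparison of codes is the linear order that extends inclusion. In particular,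
  intersecting a finite set with another set cannot raise its code.\<close>

lemma set_encode_mono: "finite B \<Longrightarrow> A \<subseteq> B \<Longrightarrow> set_encode A \<le> set_encode B"
  unfolding set_encode_def by (rule sum_mono2) auto

section \<open>The exchange of two variables\<close>

locale two_slots =
  fixes p q :: nat and K :: "nat set"
  assumes pq: "p \<noteq> q" "p \<in> K" "q \<in> K" and finK: "finite K"
begin

abbreviation Z where "Z \<equiv> K - {p, q}"

definition sw :: "((nat \<Rightarrow> 'v) \<Rightarrow> bit) \<Rightarrow> (nat \<Rightarrow> 'v) \<Rightarrow> bit" where
  "sw f x = f (x \<circ> Transposition.transpose p q)"

text \<open>For \<open>f\<close> = \<alpha> this is \<phi>. It is invariant under \<open>sw\<close>
  and, in characteristic 2, vanishes when the two variables agree.\<close>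

definition sym_sum :: "((nat \<Rightarrow> 'v) \<Rightarrow> bit) \<Rightarrow> (nat \<Rightarrow> 'v) \<Rightarrow> bit" where
  "sym_sum f = f + sw f"

lemma sw_add: "sw (f + g) = sw f + sw g"
  by (simp add: fun_eq_iff sw_def)

lemma sw_mult: "sw (f * g) = sw f * sw g"
  by (simp add: fun_eq_iff sw_def)

lemma sw_zero: "sw 0 = 0"
  by (simp add: fun_eq_iff sw_def)

lemma sw_sw: "sw (sw f) = f"
  by (simp add: fun_eq_iff sw_def comp_assoc)

lemma sym_sum_add: "sym_sum (f + g) = sym_sum f + sym_sum g"
  by (simp only: sym_sum_def sw_add ac_simps)

lemma sym_sum_zero: "sym_sum 0 = 0"
  by (simp add: sym_sum_def sw_zero)

lemma sw_sym_sum: "sw (sym_sum f) = sym_sum f"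
  by (simp only: sym_sum_def sw_add sw_sw add.commute)

lemma mform_sw:
  assumes f: "mform I f" and J: "Transposition.transpose p q ` I = J"
  shows "mform J (sw f)"
  unfolding mform_def
proof (intro conjI ballI allI impI)
  fix x :: "nat \<Rightarrow> 'a" and i u v
  assume "i \<in> J"
  then have i: "Transposition.transpose p q i \<in> I" using J by force
  have "x(i := w) \<circ> Transposition.transpose p q =
    (x \<circ> Transposition.transpose p q)(Transposition.transpose p q i := w)" for w
    by (auto simp: fun_eq_iff transpose_def)
  then show "sw f (x(i := u + v)) = sw f (x(i := u)) + sw f (x(i := v))"
    by (simp only: sw_def mform_add_at[OF f i])
next
  fix x y :: "nat \<Rightarrow> 'a" assume "\<forall>i\<in>J. x i = y i"
  then show "sw f x = sw f y"
    unfolding sw_def using J by (intro mform_cong[OF f]) auto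
qed

lemma transpose_image_insert:
  assumes "I \<subseteq> Z"
  shows "Transposition.transpose p q ` I = I"
    "Transposition.transpose p q ` insert p I = insert q I"
    "Transposition.transpose p q ` insert q I = insert p I"
proof -
  show *: "Transposition.transpose p q ` I = I"
    using assms by (force simp: transpose_def image_iff)
  show "Transposition.transpose p q ` insert p I = insert q I"
    "Transposition.transpose p q ` insert q I = insert p I" by (simp_all add: *)
qed

lemma sw_eq:
  assumes "mform I f" "I \<subseteq> Z"
  shows "sw f = f"
proof
  fix x
  show "sw f x = f x"
    unfolding sw_def using assms(2) by (intro mform_cong[OF assms(1)]) (auto simp: transpose_def)
qed

lemma finite_Z: "I \<subseteq> Z \<Longrightarrow> finite I"
  using finK by (meson finite_Diff finite_subset)

section \<open>Classes of products\<close>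

definition PR :: "((nat \<Rightarrow> 'v::ab_group_add) \<Rightarrow> bit) set" where
  "PR = {f * g |f g. \<exists>I. I \<noteq> {} \<and> I \<subset> K \<and> mform I f \<and> mform (K - I) g}"

text \<open>The distinguished variables lie in one factor for \<open>T1\<close> and in two factors
  for \<open>T2\<close>; \<open>W\<close> bounds the codes that are still to be eliminated. Here
  \<open>I\<close> is proper, so that \<open>w\<close> has at least one variable.\<close>

definition T1 :: "nat \<Rightarrow> ((nat \<Rightarrow> 'v::ab_group_add) \<Rightarrow> bit) set" where
  "T1 W = {\<beta> * w |\<beta> w. \<exists>I. I \<subset> Z \<and> set_encode I < W \<and>
    mform ({p, q} \<union> I) \<beta> \<and> mform (Z - I) w}"

text \<open>The factor \<open>w\<close> may be a constant: a product of two factors that separates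
  \<open>p\<close> from \<open>q\<close> is covered by \<open>w = 1\<close>.\<close>

definition T2 :: "nat \<Rightarrow> ((nat \<Rightarrow> 'v::ab_group_add) \<Rightarrow> bit) set" where
  "T2 W = {\<beta> * (\<gamma> * w) |\<beta> \<gamma> w. \<exists>I J. I \<subseteq> Z \<and> J \<subseteq> Z \<and> I \<inter> J = {} \<and>
    set_encode I < W \<and> set_encode J < W \<and>
    mform (insert p I) \<beta> \<and> mform (insert q J) \<gamma> \<and> mform (Z - I - J) w}"

lemma PR_I: "mform I f \<Longrightarrow> mform (K - I) g \<Longrightarrow> I \<noteq> {} \<Longrightarrow> I \<subset> K \<Longrightarrow> f * g \<in> PR"
  unfolding PR_def by blast

lemma T1_I:
  "mform ({p, q} \<union> I) \<beta> \<Longrightarrow> mform (Z - I) w \<Longrightarrow> I \<subset> Z \<Longrightarrow> set_encode I < W \<Longrightarrow> \<beta> * w \<in> T1 W"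
  unfolding T1_def by blast

lemma T2_I:
  "mform (insert p I) \<beta> \<Longrightarrow> mform (insert q J) \<gamma> \<Longrightarrow> mform (Z - I - J) w \<Longrightarrow>
   I \<subseteq> Z \<Longrightarrow> J \<subseteq> Z \<Longrightarrow> I \<inter> J = {} \<Longrightarrow> set_encode I < W \<Longrightarrow> set_encode J < W \<Longrightarrow>
   \<beta> * (\<gamma> * w) \<in> T2 W"
  unfolding T2_def by blast

lemma T1_E:
  assumes "t \<in> T1 W"
  obtains I \<beta> w where "t = \<beta> * w" "mform ({p, q} \<union> I) \<beta>" "mform (Z - I) w" "I \<subset> Z"
    "set_encode I < W"
  using assms unfolding T1_def by blast

lemma T2_E:
  assumes "t \<in> T2 W"
  obtains I J \<beta> \<gamma> w where "t = \<beta> * (\<gamma> * w)" "mform (insert p I) \<beta>" "mform (insert q J) \<gamma>"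
    "mform (Z - I - J) w" "I \<subseteq> Z" "J \<subseteq> Z" "I \<inter> J = {}" "set_encode I < W" "set_encode J < W"
  using assms unfolding T2_def by blast

lemma zero_in_PR: "0 \<in> PR"
  using PR_I[of "{p}" 0 0] pq by (auto simp: mform_zero)

lemma mform_PR:
  assumes "t \<in> PR"
  shows "mform K t"
proof -
  obtain I f g where "t = f * g" "I \<subset> K" "mform I f" "mform (K - I) g"
    using assms unfolding PR_def by blast
  then show ?thesis using mform_mult'[of I f "K - I" g K] by auto
qed

lemma mform_sums_PR: "f \<in> sums_of N PR \<Longrightarrow> mform K f"
  by (rule mform_sums_of[of f N]) (auto elim: sums_of_mono simp: mform_PR)

text \<open>With \<open>\<gamma> * w\<close> as one factor, the variables are split into
  \<open>insert p I\<close> and its complement, which contains \<open>q\<close>.\<close>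

lemma T2_PR:
  assumes "t \<in> T2 W"
  shows "t \<in> PR"
  using assms
proof (rule T2_E)
  fix I J \<beta> \<gamma> w
  assume t: "t = \<beta> * (\<gamma> * w)" "mform (insert p I) \<beta>" "mform (insert q J) \<gamma>"
    "mform (Z - I - J) w" "I \<subseteq> Z" "J \<subseteq> Z" "I \<inter> J = {}"
  have "mform (K - insert p I) (\<gamma> * w)"
    by (rule mform_mult'[OF t(3,4)]) (use t pq in auto)
  then show ?thesis unfolding t(1) by (intro PR_I[OF t(2)]) (use t pq in auto)
qed

lemma sw_T2:
  assumes "t \<in> T2 W"
  shows "sw t \<in> T2 W"
  using assms
proof (rule T2_E)
  fix I J \<beta> \<gamma> w
  assume t: "t = \<beta> * (\<gamma> * w)" "mform (insert p I) \<beta>" "mform (insert q J) \<gamma>"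
    "mform (Z - I - J) w" "I \<subseteq> Z" "J \<subseteq> Z" "I \<inter> J = {}" "set_encode I < W" "set_encode J < W"
  have "sw t = sw \<gamma> * (sw \<beta> * w)"
    using sw_eq[OF t(4)] by (simp add: t(1) sw_mult mult.left_commute Diff_subset_conv subset_iff)
  moreover have "mform (insert p J) (sw \<gamma>)" "mform (insert q I) (sw \<beta>)"
    using mform_sw[OF t(3) transpose_image_insert(3)[OF t(6)]]
      mform_sw[OF t(2) transpose_image_insert(2)[OF t(5)]] by auto
  moreover have "Z - I - J = Z - J - I" by auto
  then have "mform (Z - J - I) w" using t(4) by simp
  ultimately show ?thesis
    using t(5-9) T2_I[of J "sw \<gamma>" I "sw \<beta>" w W] by (simp add: Int_commute)
qed

text \<open>
  A vector \<open>e\<close> with \<open>\<theta> e = 1\<close> that is annihilated by the other linear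
  forms allows one to remove \<open>\<theta>\<close> by subtracting \<open>\<theta>(x\<^sub>p) \<phi>(e, x\<^sub>q) + \<theta>(x\<^sub>q) \<phi>(x\<^sub>p, e)\<close>.
\<close>

lemma eliminate_linear_forms:
  assumes "mform K a" "\<And>\<theta>. \<theta> \<in> set \<theta>s \<Longrightarrow> mform {p} \<theta>"
    and "\<And>x. (\<And>\<theta>. \<theta> \<in> set \<theta>s \<Longrightarrow> \<theta> x = 0) \<Longrightarrow> sym_sum a x = 0"
  shows "\<exists>\<psi>\<in>sums_of (length \<theta>s) PR. sym_sum a = sym_sum \<psi>"
  using assms
proof (induction \<theta>s arbitrary: a)
  case Nil
  then have "sym_sum a = 0" by (simp add: fun_eq_iff)
  then show ?case by (metis sums_of_zero sym_sum_zero)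
next
  case (Cons \<theta> \<theta>s)
  show ?case
  proof (cases "\<exists>e. \<theta> e = 1 \<and> (\<forall>\<eta>\<in>set \<theta>s. \<eta> e = 0)")
    case False
    then have "\<theta> x = 0" if "\<And>\<eta>. \<eta> \<in> set \<theta>s \<Longrightarrow> \<eta> x = 0" for x
      using that by (metis bit_not_zero_iff)
    then have "\<exists>\<psi>\<in>sums_of (length \<theta>s) PR. sym_sum a = sym_sum \<psi>"
      using Cons.prems by (intro Cons.IH) auto
    then obtain \<psi> where "\<psi> \<in> sums_of (length \<theta>s) PR" "sym_sum a = sym_sum \<psi>" by blast
    moreover from this have "\<psi> \<in> sums_of (length (\<theta> # \<theta>s)) PR" by (auto elim: sums_of_mono)
    ultimately show ?thesis by blast
  next
    case True
    then obtain e where e: "\<theta> e = 1" "\<And>\<eta>. \<eta> \<in> set \<theta>s \<Longrightarrow> \<eta> e = 0" by blast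
    let ?D = "sym_sum a" and ?\<tau> = "Transposition.transpose p q"
    have D: "mform K ?D"
      unfolding sym_sum_def
      using Cons.prems(1) pq by (intro mform_add mform_sw[OF Cons.prems(1)]) auto
    have Dsw: "?D (x \<circ> ?\<tau>) = ?D x" for x
      using fun_cong[OF sw_sym_sum[of a], of x] by (simp add: sw_def)
    \<comment> \<open>\<phi> is alternating, not merely symmetric: its two summands agree here and
      cancel.\<close>
    have Dalt: "?D x = 0" if "x p = x q" for x
    proof -
      have "x \<circ> ?\<tau> = x" using that by (auto simp: fun_eq_iff transpose_def)
      then show ?thesis by (simp add: sym_sum_def sw_def)
    qed
    \<comment> \<open>The linear forms see only the vector \<open>e p\<close>. It replaces
      \<open>x p\<close> in \<phi>; by symmetry of \<phi>, the exchanged product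
      \<open>sw (\<theta> * v)\<close> has it in place of \<open>x q\<close>.\<close>
    define v where "v x = ?D (x(p := e p))" for x
    have v: "mform (K - {p}) v"
      unfolding mform_def
    proof (intro conjI ballI allI impI)
      fix x :: "nat \<Rightarrow> 'a" and i u w
      assume i: "i \<in> K - {p}"
      then have "(x(i := s))(p := e p) = (x(p := e p))(i := s)" for s by auto
      then show "v (x(i := u + w)) = v (x(i := u)) + v (x(i := w))"
        using i mform_add_at[OF D] by (simp only: v_def) auto
    next
      fix x y :: "nat \<Rightarrow> 'a" assume "\<forall>i\<in>K - {p}. x i = y i"
      then show "v x = v y" unfolding v_def by (intro mform_cong[OF D]) auto
    qed
    have \<theta>: "mform {p} \<theta>" using Cons.prems(2) by simp
    define \<psi> where "\<psi> = \<theta> * v"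
    have \<psi>: "\<psi> \<in> PR" unfolding \<psi>_def using pq by (intro PR_I[OF \<theta> v]) auto
    have sw\<psi>: "sw \<psi> x = \<theta> (x \<circ> ?\<tau>) * ?D (x(q := e p))" for x
    proof -
      have "(x \<circ> ?\<tau>)(p := e p) \<circ> ?\<tau> = x(q := e p)"
        using pq by (auto simp: fun_eq_iff transpose_def)
      then have "?D ((x \<circ> ?\<tau>)(p := e p)) = ?D (x(q := e p))" using Dsw by metis
      then show ?thesis by (simp add: sw_def \<psi>_def v_def)
    qed
    have vanish: "sym_sum (a + \<psi>) x = 0" if x: "\<And>\<eta>. \<eta> \<in> set \<theta>s \<Longrightarrow> \<eta> x = 0" for x
    proof -
      have expand: "sym_sum (a + \<psi>) x =
          ?D x + (\<theta> x * ?D (x(p := e p)) + \<theta> (x \<circ> ?\<tau>) * ?D (x(q := e p)))"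
        using sw\<psi>[of x] by (simp only: sym_sum_add plus_fun_apply sym_sum_def[of \<psi>])
          (simp only: \<psi>_def times_fun_apply v_def)
      have zero: "?D y = 0" if "\<theta> y = 0" "\<And>\<eta>. \<eta> \<in> set \<theta>s \<Longrightarrow> \<eta> y = 0" for y
        using that by (intro Cons.prems(3)) auto
      show ?thesis
      proof (cases "\<theta> x = 0")
        case True
        have upd: "\<eta> (x(q := e p)) = \<eta> x" if "\<eta> \<in> set (\<theta> # \<theta>s)" for \<eta>
          using pq by (intro mform_cong[OF Cons.prems(2)[OF that]]) auto
        have "?D (x(q := e p)) = 0"
        proof (rule zero)
          show "\<theta> (x(q := e p)) = 0" using upd[of \<theta>] True by simp
          show "\<eta> (x(q := e p)) = 0" if "\<eta> \<in> set \<theta>s" for \<eta> using upd[of \<eta>] x[of \<eta>] that by simp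
        qed
        moreover have "?D x = 0" using zero True x by blast
        ultimately show ?thesis unfolding expand by (simp add: True)
      next
        case False
        \<comment> \<open>Now \<open>\<theta> x = 1\<close>, and adding \<open>e p\<close> to
          \<open>x p\<close> leads into the common kernel of all the forms, where \<phi> vanishes
          for every choice of \<open>x q\<close>. The choice \<open>x q\<close> cancels the first
          product; the choice \<open>e p\<close>, with alternation, kills the second one.\<close>
        define y where "y = x(p := x p + e p)"
        have add: "\<eta> (x(p := x p + e p, q := s)) = \<eta> x + \<eta> e" if "mform {p} \<eta>" for \<eta> s
        proof -
          have "\<eta> (x(p := x p + e p, q := s)) = \<eta> (x(p := x p + e p))"
            "\<eta> (x(p := e p)) = \<eta> e"
            using pq by (auto intro!: mform_cong[OF that])
          then show ?thesis using mform_add_at[OF that, of p x "x p" "e p"] by simp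
        qed
        have y0: "?D (y(q := s)) = 0" for s
          unfolding y_def using False e x Cons.prems(2) by (intro zero) (simp_all add: add)
        have "y(q := x q) = y" using pq by (auto simp: y_def)
        then have "?D y = 0" using y0[of "x q"] by simp
        moreover have "?D y = ?D x + ?D (x(p := e p))"
          unfolding y_def using mform_add_at[OF D pq(2), of x "x p" "e p"] by simp
        moreover have "?D (x(q := e p)) = 0"
        proof -
          have "y(q := e p) = x(q := e p, p := x p + e p)" using pq by (auto simp: y_def)
          moreover have "?D (x(q := e p, p := e p)) = 0" using pq by (intro Dalt) auto
          moreover have "x(q := e p, p := x p) = x(q := e p)" using pq by auto
          ultimately show ?thesis
            using y0[of "e p"] mform_add_at[OF D pq(2), of "x(q := e p)" "x p" "e p"] by simp
        qed
        ultimately show ?thesis unfolding expand using False by simp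
      qed
    qed
    have "\<exists>\<psi>'\<in>sums_of (length \<theta>s) PR. sym_sum (a + \<psi>) = sym_sum \<psi>'"
    proof (rule Cons.IH)
      show "mform K (a + \<psi>)" by (rule mform_add[OF Cons.prems(1) mform_PR[OF \<psi>]])
      show "mform {p} \<eta>" if "\<eta> \<in> set \<theta>s" for \<eta> using Cons.prems(2) that by simp
    qed (rule vanish)
    then obtain \<psi>' where \<psi>': "\<psi>' \<in> sums_of (length \<theta>s) PR" "sym_sum (a + \<psi>) = sym_sum \<psi>'"
      by blast
    have "\<psi> + \<psi>' \<in> sums_of (1 + length \<theta>s) PR"
      using \<psi> \<psi>'(1) by (intro sums_of_add sums_of_single)
    moreover have "sym_sum a = sym_sum (\<psi> + \<psi>')"
      unfolding sym_sum_add \<psi>'(2)[symmetric] by (metis add.commute bit_fun_add_cancel)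
    ultimately show ?thesis by auto
  qed
qed

section \<open>Elimination when the two variables are in different factors\<close>

lemma eliminate_T2:
  "\<exists>b. poly_bounded b \<and> (\<forall>(a :: (nat \<Rightarrow> 'v::ab_group_add) \<Rightarrow> bit) N. mform K a \<longrightarrow>
    sym_sum a \<in> sums_of N (T2 (Suc W)) \<longrightarrow> (\<exists>\<psi>\<in>sums_of (b N) PR. sym_sum a = sym_sum \<psi>))"
proof (induction W)
  case 0
  have "\<exists>\<psi>\<in>sums_of N PR. sym_sum a = sym_sum \<psi>"
    if a: "mform K a" "sym_sum a \<in> sums_of N (T2 (Suc 0))"
    for a :: "(nat \<Rightarrow> 'v) \<Rightarrow> bit" and N
  proof -
    obtain ts where ts: "sym_sum a = sum_list ts" "length ts \<le> N" "set ts \<subseteq> T2 (Suc 0)"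
      using a(2) by (rule sums_ofE)
    have "\<exists>\<theta>. mform {p} \<theta> \<and> (\<exists>g. t = \<theta> * g)" if t: "t \<in> T2 (Suc 0)"
      for t :: "(nat \<Rightarrow> 'v) \<Rightarrow> bit"
      using t
    proof (rule T2_E)
      fix I J \<beta> \<gamma> w
      assume t: "t = \<beta> * (\<gamma> * w)" "mform (insert p I) \<beta>" "I \<subseteq> Z" "set_encode I < Suc 0"
      \<comment> \<open>Only the empty set has code 0, so every term contains a linear form in the
        variable \<open>p\<close>.\<close>
      have "I = {}"
        using t(3,4) finite_Z[of I] set_encode_inverse[of I] by simp
      then show ?thesis using t by blast
    qed
    then have "\<forall>t\<in>T2 (Suc 0). \<exists>\<theta>. mform {p} \<theta> \<and> (\<exists>g :: (nat \<Rightarrow> 'v) \<Rightarrow> bit. t = \<theta> * g)" by blast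
    from bchoice[OF this] obtain \<theta> where
      \<theta>: "\<And>t :: (nat \<Rightarrow> 'v) \<Rightarrow> bit. t \<in> T2 (Suc 0) \<Longrightarrow> mform {p} (\<theta> t) \<and> (\<exists>g. t = \<theta> t * g)"
      by blast
    have "sum_list ts x = 0"
      if "\<And>\<eta>. \<eta> \<in> set (map \<theta> ts) \<Longrightarrow> \<eta> x = 0" "set ts \<subseteq> T2 (Suc 0)" for x
      using that
    proof (induction ts)
      case (Cons t ts)
      obtain g where "t = \<theta> t * g" using \<theta>[of t] Cons.prems(2) by auto
      then have "t x = \<theta> t x * g x" by (metis times_fun_apply)
      then show ?case using Cons by simp
    qed simp
    then have "\<exists>\<psi>\<in>sums_of (length (map \<theta> ts)) PR. sym_sum a = sym_sum \<psi>"
      using \<theta> ts by (intro eliminate_linear_forms a) auto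
    then show ?thesis using ts(2) by (metis length_map order_refl sums_of_mono)
  qed
  then show ?case using poly_bounded_id by blast
next
  case (Suc W)
  \<comment> \<open>\<open>V\<close> is the largest code in play and \<open>I0\<close> the only
    finite set with this code. It is nonempty because \<open>V > 0\<close>.\<close>
  define V where "V = Suc W"
  define I0 where "I0 = set_decode V"
  define A where "A = insert p I0"
  \<comment> \<open>\<open>X\<close> holds the terms with \<open>I = I0\<close>, and
    \<open>G\<close> their cofactors. \<open>Sl\<close> holds the forms on \<open>A\<close> that
    split further, the factor with \<open>p\<close> carrying a set of smaller code.\<close>
  define G :: "((nat \<Rightarrow> 'v) \<Rightarrow> bit) set" where
    "G = {\<gamma> * w |\<gamma> w. \<exists>J. I0 \<subseteq> Z \<and> J \<subseteq> Z \<and> I0 \<inter> J = {} \<and> set_encode J < V \<and>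
        mform (insert q J) \<gamma> \<and> mform (Z - I0 - J) w}"
  define X :: "((nat \<Rightarrow> 'v) \<Rightarrow> bit) set" where "X = {\<beta> * g |\<beta> g. mform A \<beta> \<and> g \<in> G}"
  define Sl :: "((nat \<Rightarrow> 'v) \<Rightarrow> bit) set" where
    "Sl = {\<delta> * \<epsilon> |\<delta> \<epsilon>. \<exists>I1. I1 \<subseteq> I0 \<and> set_encode I1 < V \<and> mform (insert p I1) \<delta> \<and>
        mform (I0 - I1) \<epsilon>}"
  have encI0: "finite I0" "set_encode I0 = V" by (simp_all add: I0_def)
  have eqI0: "I = I0" if "I \<subseteq> Z" "set_encode I = V" for I
    using that finite_Z[of I] set_encode_inverse[of I] by (simp add: I0_def)
  obtain b where b: "poly_bounded b" "\<And>(a :: (nat \<Rightarrow> 'v) \<Rightarrow> bit) N. mform K a \<Longrightarrow>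
      sym_sum a \<in> sums_of N (T2 V) \<Longrightarrow> \<exists>\<psi>\<in>sums_of (b N) PR. sym_sum a = sym_sum \<psi>"
    using Suc.IH unfolding V_def by blast
  show ?case
  proof (cases "I0 \<subseteq> Z")
    case False
    have "T2 (Suc V) \<subseteq> (T2 V :: ((nat \<Rightarrow> 'v) \<Rightarrow> bit) set)"
    proof
      fix t :: "(nat \<Rightarrow> 'v) \<Rightarrow> bit"
      assume "t \<in> T2 (Suc V)"
      then show "t \<in> T2 V"
      proof (rule T2_E)
        fix I J \<beta> \<gamma> w
        assume t: "t = \<beta> * (\<gamma> * w)" "mform (insert p I) \<beta>" "mform (insert q J) \<gamma>"
          "mform (Z - I - J) w" "I \<subseteq> Z" "J \<subseteq> Z" "I \<inter> J = {}"
          "set_encode I < Suc V" "set_encode J < Suc V"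
        then have "set_encode I \<noteq> V" "set_encode J \<noteq> V" using False eqI0 by metis+
        then show ?thesis unfolding t(1) using t by (intro T2_I[of I _ J]) auto
      qed
    qed
    then show ?thesis using b sums_of_mono unfolding V_def by (metis order_refl)
  next
    case I0: True
    \<comment> \<open>On \<open>A\<close>, the factor with \<open>p\<close> of such a term is left
      with \<open>I \<inter> I0\<close>, whose code is still below \<open>V\<close>.\<close>
    have slice_T2: "slice A x t \<in> Sl" if "t \<in> T2 V" for t :: "(nat \<Rightarrow> 'v) \<Rightarrow> bit" and x
      using that
    proof (rule T2_E)
      fix I J \<beta> \<gamma> w
      assume t: "t = \<beta> * (\<gamma> * w)" "mform (insert p I) \<beta>" "mform (insert q J) \<gamma>"
        "mform (Z - I - J) w" "I \<subseteq> Z" "J \<subseteq> Z" "I \<inter> J = {}" "set_encode I < V"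
      have "mform (insert p (I \<inter> I0)) (slice A x \<beta>)"
        by (rule mform_slice'[OF t(2)]) (auto simp: A_def)
      moreover have "mform (I0 - I \<inter> I0) (slice A x (\<gamma> * w))"
        by (rule mform_slice'[OF mform_mult'[OF t(3,4) _ refl]]) (use t pq I0 in \<open>auto simp: A_def\<close>)
      moreover have "set_encode (I \<inter> I0) < V"
        using set_encode_mono[OF finite_Z[OF t(5)], of "I \<inter> I0"] t(8) by simp
      moreover have "I \<inter> I0 \<subseteq> I0" by blast
      ultimately show ?thesis
        unfolding t(1) Sl_def slice_mult[of A x \<beta>] by blast
    qed
    \<comment> \<open>For \<open>t\<close> in \<open>X\<close>, the exchange hands the variable
      \<open>p\<close> to \<open>\<gamma>\<close>, whose set \<open>J\<close> is disjoint from
      \<open>I0\<close>. On \<open>A\<close> this factor depends on \<open>p\<close> alone, and the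
      empty set has code 0, below \<open>V\<close>.\<close>
    have slice_sw: "slice A x (sw t) \<in> Sl" if tX: "t \<in> X \<union> T2 V" for t :: "(nat \<Rightarrow> 'v) \<Rightarrow> bit" and x
    proof (cases "t \<in> T2 V")
      case True
      then show ?thesis by (intro slice_T2 sw_T2)
    next
      case False
      then obtain \<beta> \<gamma> w J where t: "t = \<beta> * (\<gamma> * w)" "mform (insert p I0) \<beta>" "J \<subseteq> Z"
        "I0 \<inter> J = {}" "mform (insert q J) \<gamma>" "mform (Z - I0 - J) w"
        using tX unfolding X_def G_def A_def by blast
      have "sw w = w" by (rule sw_eq[OF t(6)]) auto
      have "mform (insert p {}) (slice A x (sw \<gamma>))"
        by (rule mform_slice'[OF mform_sw[OF t(5) refl]])
          (use t I0 pq in \<open>auto simp: A_def transpose_image_insert\<close>)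
      moreover have "mform (insert q I0 \<union> (Z - I0 - J)) (sw \<beta> * w)"
        by (rule mform_mult[OF mform_sw[OF t(2)] t(6)])
          (use I0 in \<open>auto simp: transpose_image_insert\<close>)
      then have "mform (I0 - {}) (slice A x (sw \<beta> * w))"
        by (rule mform_slice') (use I0 pq in \<open>auto simp: A_def\<close>)
      moreover have "set_encode {} < V" by (simp add: V_def)
      moreover have "sw t = sw \<gamma> * (sw \<beta> * w)"
        unfolding t(1) by (simp only: sw_mult \<open>sw w = w\<close> ac_simps)
      then have "slice A x (sw t) = slice A x (sw \<gamma>) * slice A x (sw \<beta> * w)"
        by (simp only: slice_mult)
      moreover have "{} \<subseteq> I0" by blast
      ultimately show ?thesis unfolding Sl_def by blast
    qed
    have Sl_G: "s * g \<in> T2 V" if "s \<in> Sl" "g \<in> G" for s g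
    proof -
      obtain \<delta> \<epsilon> I1 where s: "s = \<delta> * \<epsilon>" "I1 \<subseteq> I0" "set_encode I1 < V" "mform (insert p I1) \<delta>"
        "mform (I0 - I1) \<epsilon>" using \<open>s \<in> Sl\<close> unfolding Sl_def by blast
      obtain \<gamma> w J where g: "g = \<gamma> * w" "J \<subseteq> Z" "I0 \<inter> J = {}" "set_encode J < V"
        "mform (insert q J) \<gamma>" "mform (Z - I0 - J) w" using \<open>g \<in> G\<close> unfolding G_def by blast
      have "mform (Z - I1 - J) (\<epsilon> * w)"
        by (rule mform_mult'[OF s(5) g(6)]) (use s g I0 in auto)
      then have "\<delta> * (\<gamma> * (\<epsilon> * w)) \<in> T2 V"
        using s g I0 by (intro T2_I[of I1 _ J]) auto
      then show ?thesis by (simp only: s g ac_simps)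
    qed
    \<comment> \<open>If \<open>J = I0\<close>, the term is turned around by
      \<open>t = sw t + sym_sum t\<close>. The sets \<open>I\<close> and \<open>J\<close> cannot
      both be \<open>I0\<close>, since they are disjoint and \<open>I0\<close> is nonempty.\<close>
    have swap: "\<exists>u g. u \<in> X \<union> T2 V \<and> g \<in> PR \<and> t = u + sym_sum g"
      if "t \<in> T2 (Suc V)" for t :: "(nat \<Rightarrow> 'v) \<Rightarrow> bit"
      using that
    proof (rule T2_E)
      fix I J \<beta> \<gamma> w
      assume t: "t = \<beta> * (\<gamma> * w)" "mform (insert p I) \<beta>" "mform (insert q J) \<gamma>"
        "mform (Z - I - J) w" "I \<subseteq> Z" "J \<subseteq> Z" "I \<inter> J = {}"
        "set_encode I < Suc V" "set_encode J < Suc V"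
      consider "set_encode I < V" "set_encode J < V" | "set_encode I = V" | "set_encode J = V"
        using t by linarith
      then show ?thesis
      proof cases
        case 1
        then have "t \<in> T2 V" unfolding t(1) using t by (intro T2_I[of I _ J]) auto
        then show ?thesis using zero_in_PR sym_sum_zero by (metis UnI2 add.right_neutral)
      next
        case 2
        then have I: "I = I0" using t eqI0 by blast
        have "set_encode J \<noteq> V"
        proof
          assume "set_encode J = V"
          then have "J = I0" using t eqI0 by blast
          then have "I0 = {}" using I t by blast
          then show False using encI0 by (simp add: V_def)
        qed
        then have "set_encode J < V" using t by linarith
        then have "t \<in> X" using t I unfolding X_def G_def A_def by blast
        then show ?thesis using zero_in_PR sym_sum_zero by (metis UnI1 add.right_neutral)
      next
        case 3
        then have J: "J = I0" using t eqI0 by blast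
        have "set_encode I \<noteq> V"
        proof
          assume "set_encode I = V"
          then have "I = I0" using t eqI0 by blast
          then have "I0 = {}" using J t by blast
          then show False using encI0 by (simp add: V_def)
        qed
        then have enc: "set_encode I < V" using t by linarith
        have "sw w = w" by (rule sw_eq[OF t(4)]) auto
        then have "sw t = sw \<gamma> * (sw \<beta> * w)" unfolding t(1) by (simp only: sw_mult ac_simps)
        moreover have "mform (insert p I0) (sw \<gamma>)" "mform (insert q I) (sw \<beta>)"
          using mform_sw[OF t(3) transpose_image_insert(3)[OF t(6)]]
            mform_sw[OF t(2) transpose_image_insert(2)[OF t(5)]] J by auto
        moreover have "Z - I - J = Z - I0 - I" using J by auto
        then have "mform (Z - I0 - I) w" using t(4) by simp
        ultimately have "sw t \<in> X" using t J enc unfolding X_def G_def A_def by blast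
        moreover have "t = sw t + sym_sum t"
          unfolding sym_sum_def by (metis add.commute bit_fun_add_cancel)
        ultimately show ?thesis using T2_PR[OF that] by blast
      qed
    qed
    \<comment> \<open>Each of at most \<open>N\<close> products consists of a slice with
      \<open>N + N\<close> summands and a cofactor with \<open>N\<close>. The inner
      \<open>+ N\<close> counts the terms already in \<open>T2 V\<close>, the outer one the
      correction \<open>g\<close>.\<close>
    define b' where "b' N = b (N * ((N + N) * N) + N) + N" for N
    have "poly_bounded b'"
      unfolding b'_def
      by (intro poly_bounded_add poly_bounded_compose[OF b(1)] poly_bounded_mult poly_bounded_id)
    moreover have "\<exists>\<psi>\<in>sums_of (b' N) PR. sym_sum a = sym_sum \<psi>"
      if a: "mform K a" "sym_sum a \<in> sums_of N (T2 (Suc V))" for a :: "(nat \<Rightarrow> 'v) \<Rightarrow> bit" and N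
    proof -
      obtain u g where u: "u \<in> sums_of N (X \<union> T2 V)" and g: "g \<in> sums_of N PR"
        and D: "sym_sum a = u + sym_sum g"
        by (rule sums_of_replace[of "sym_sum a" N "T2 (Suc V)" "X \<union> T2 V" PR sym_sum])
          (use a swap sym_sum_zero sym_sum_add in auto)
      have D': "sym_sum (a + g) = u" unfolding sym_sum_add D by (simp add: add.assoc)
      obtain F h where F: "F \<in> sums_of N X" and h: "h \<in> sums_of N (T2 V)" and uFh: "u = F + h"
        using u by (rule sums_of_split)
      have G: "\<exists>B. mform B g \<and> A \<inter> B = {}" if "g \<in> G" for g
      proof -
        obtain \<gamma> w J where g: "g = \<gamma> * w" "J \<subseteq> Z" "I0 \<inter> J = {}"
          "mform (insert q J) \<gamma>" "mform (Z - I0 - J) w" using \<open>g \<in> G\<close> unfolding G_def by blast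
        have "mform (insert q J \<union> (Z - I0 - J)) g"
          unfolding g(1) by (rule mform_mult[OF g(4,5)]) auto
        moreover have "A \<inter> (insert q J \<union> (Z - I0 - J)) = {}"
          using g I0 pq by (auto simp: A_def)
        ultimately show ?thesis by blast
      qed
      obtain M x k where M: "M \<le> N" and k: "\<And>j. j < M \<Longrightarrow> k j \<in> sums_of N G"
        and Fk: "F = (\<Sum>j<M. slice A (x j) F * k j)"
        using slice_factorisation[OF F[unfolded X_def] G] by meson
      \<comment> \<open>The symmetry of \<open>u\<close> enters here. In \<open>sw u\<close> the set
        \<open>I0\<close> is no longer attached to \<open>p\<close>, which is why the slices of
        \<open>F\<close> on \<open>A\<close> split.\<close>
      have "F = sw u + h"
      proof -
        have "sw u = u" unfolding D'[symmetric] by (rule sw_sym_sum)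
        then show ?thesis unfolding uFh by (simp add: add.assoc)
      qed
      then have "slice A y F = slice A y (sw u) + slice A y h" for y by (simp only: slice_add)
      moreover have "slice A y (sw u) \<in> sums_of N Sl" for y
        by (rule sums_of_image[OF u, of "\<lambda>u. slice A y (sw u)"])
          (simp_all only: sw_add sw_zero slice_zero slice_add slice_sw)
      moreover have "slice A y h \<in> sums_of N Sl" for y
        by (rule sums_of_image[OF h]) (simp_all only: slice_zero slice_add slice_T2)
      ultimately have "slice A y F \<in> sums_of (N + N) Sl" for y
        using sums_of_add by metis
      then have "F \<in> sums_of (M * ((N + N) * N)) (T2 V)"
        by (subst Fk) (intro sums_of_sum sums_of_mult[OF _ k] Sl_G)
      then have "u \<in> sums_of (M * ((N + N) * N) + N) (T2 V)"
        unfolding uFh using h by (intro sums_of_add)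
      \<comment> \<open>\<open>M\<close> varies with \<open>a\<close>; raising it to
        \<open>N\<close> makes the argument of \<open>b\<close> depend on \<open>N\<close>
        alone.\<close>
      then have "sym_sum (a + g) \<in> sums_of (N * ((N + N) * N) + N) (T2 V)"
        unfolding D' using M by (elim sums_of_mono) auto
      then obtain \<psi> where \<psi>: "\<psi> \<in> sums_of (b (N * ((N + N) * N) + N)) PR"
        "sym_sum (a + g) = sym_sum \<psi>"
        using b(2) mform_add[OF a(1) mform_sums_PR[OF g]] by blast
      have "\<psi> + g \<in> sums_of (b' N) PR" unfolding b'_def by (rule sums_of_add[OF \<psi>(1) g])
      moreover have "sym_sum a = sym_sum (\<psi> + g)"
        unfolding sym_sum_add \<psi>(2)[symmetric] by (simp add: add.assoc)
      ultimately show ?thesis by blast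
    qed
    ultimately show ?thesis unfolding V_def by blast
  qed
qed

section \<open>Elimination when the two variables share a factor\<close>

text \<open>Removing a set from the terms of the first shape also produces new terms of the second
  shape. Hence all of \<open>T2\<close> is allowed throughout, and \<open>eliminate_T2\<close> is
  the base case.\<close>

lemma eliminate_T1:
  "\<exists>b. poly_bounded b \<and> (\<forall>(a :: (nat \<Rightarrow> 'v::ab_group_add) \<Rightarrow> bit) N. mform K a \<longrightarrow>
    sym_sum a \<in> sums_of N (T1 W \<union> T2 (Suc (set_encode Z))) \<longrightarrow>
    (\<exists>\<psi>\<in>sums_of (b N) PR. sym_sum a = sym_sum \<psi>))"
proof (induction W)
  case 0
  have "T1 0 = ({} :: ((nat \<Rightarrow> 'v) \<Rightarrow> bit) set)" by (auto simp: T1_def)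
  then show ?case using eliminate_T2[of "set_encode Z"] by simp
next
  case (Suc W)
  define T where "T = (T1 W \<union> T2 (Suc (set_encode Z)) :: ((nat \<Rightarrow> 'v) \<Rightarrow> bit) set)"
  define I0 where "I0 = set_decode W"
  define A where "A = {p, q} \<union> I0"
  define X :: "((nat \<Rightarrow> 'v) \<Rightarrow> bit) set" where
    "X = {\<beta> * g |\<beta> g. mform A \<beta> \<and> g \<in> {g. mform (Z - I0) g}}"
  have encI0: "set_encode I0 = W" by (simp add: I0_def)
  have eqI0: "I = I0" if "I \<subseteq> Z" "set_encode I = W" for I
    using that finite_Z[of I] set_encode_inverse[of I] by (simp add: I0_def)
  obtain b where b: "poly_bounded b" "\<And>(a :: (nat \<Rightarrow> 'v) \<Rightarrow> bit) N. mform K a \<Longrightarrow>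
      sym_sum a \<in> sums_of N T \<Longrightarrow> \<exists>\<psi>\<in>sums_of (b N) PR. sym_sum a = sym_sum \<psi>"
    using Suc.IH unfolding T_def by blast
  have T1_Suc: "(I0 \<subset> Z \<and> t \<in> X) \<or> t \<in> T1 W" if "t \<in> T1 (Suc W)" for t :: "(nat \<Rightarrow> 'v) \<Rightarrow> bit"
    using that
  proof (rule T1_E)
    fix I \<beta> w
    assume t: "t = \<beta> * w" "mform ({p, q} \<union> I) \<beta>" "mform (Z - I) w" "I \<subset> Z" "set_encode I < Suc W"
    show ?thesis
    proof (cases "set_encode I = W")
      case True
      then have "I = I0" using eqI0 t by blast
      then show ?thesis using t unfolding X_def A_def by blast
    next
      case False
      then show ?thesis using t T1_I[of I \<beta> w W] by auto
    qed
  qed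
  show ?case
  proof (cases "I0 \<subset> Z")
    case False
    then have "T1 (Suc W) \<union> T2 (Suc (set_encode Z)) \<subseteq> T" using T1_Suc unfolding T_def by blast
    then show ?thesis using b sums_of_mono by (metis order_refl)
  next
    case I0: True
    \<comment> \<open>Slicing intersects the sets of a term with \<open>I0\<close>, and
      \<open>g\<close> supplies the variables of \<open>Z - I0\<close>. Codes do not grow, so the
      result stays in \<open>T\<close>.\<close>
    have slice_T: "slice A x t * g \<in> T" if "t \<in> T" "mform (Z - I0) g" for t g x
    proof (cases "t \<in> T1 W")
      case True
      then show ?thesis
      proof (rule T1_E)
        fix I \<beta> w
        assume t: "t = \<beta> * w" "mform ({p, q} \<union> I) \<beta>" "mform (Z - I) w" "I \<subset> Z" "set_encode I < W"
        have "mform ({p, q} \<union> (I \<inter> I0)) (slice A x \<beta>)"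
          by (rule mform_slice'[OF t(2)]) (auto simp: A_def)
        moreover have "mform ((Z - I) \<inter> A) (slice A x w)" by (rule mform_slice[OF t(3)])
        then have "mform (Z - I \<inter> I0) (slice A x w * g)"
          by (rule mform_mult'[OF _ that(2)]) (use t I0 in \<open>auto simp: A_def\<close>)
        moreover have "set_encode (I \<inter> I0) < W"
          using set_encode_mono[OF finite_Z[of I], of "I \<inter> I0"] t(4,5) by auto
        ultimately have "slice A x \<beta> * (slice A x w * g) \<in> T1 W"
          using t(4) by (intro T1_I) auto
        then show ?thesis unfolding T_def t(1) slice_mult mult.assoc by blast
      qed
    next
      case False
      then have "t \<in> T2 (Suc (set_encode Z))" using that(1) by (auto simp: T_def)
      then show ?thesis
      proof (rule T2_E)
        fix I J \<beta> \<gamma> w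
        assume t: "t = \<beta> * (\<gamma> * w)" "mform (insert p I) \<beta>" "mform (insert q J) \<gamma>"
          "mform (Z - I - J) w" "I \<subseteq> Z" "J \<subseteq> Z" "I \<inter> J = {}"
        have 1: "mform (insert p (I \<inter> I0)) (slice A x \<beta>)"
          by (rule mform_slice'[OF t(2)]) (use t(5) in \<open>auto simp: A_def\<close>)
        have 2: "mform (insert q (J \<inter> I0)) (slice A x \<gamma>)"
          by (rule mform_slice'[OF t(3)]) (use t(6) in \<open>auto simp: A_def\<close>)
        have "mform ((Z - I - J) \<inter> A) (slice A x w)" by (rule mform_slice[OF t(4)])
        then have 3: "mform (Z - I \<inter> I0 - J \<inter> I0) (slice A x w * g)"
          by (rule mform_mult'[OF _ that(2)]) (use t I0 in \<open>auto simp: A_def\<close>)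
        have "set_encode (I \<inter> I0) < Suc (set_encode Z)" "set_encode (J \<inter> I0) < Suc (set_encode Z)"
          using t(5,6) finite_Z[of Z] by (auto simp: less_Suc_eq_le intro!: set_encode_mono)
        then have "slice A x \<beta> * (slice A x \<gamma> * (slice A x w * g)) \<in> T2 (Suc (set_encode Z))"
          using t(5-7) by (intro T2_I[OF 1 2 3]) auto
        then show ?thesis unfolding T_def t(1) slice_mult mult.assoc by blast
      qed
    qed
    define b' where "b' N = b (N * N + N) + N" for N
    have "poly_bounded b'"
      unfolding b'_def
      by (intro poly_bounded_add poly_bounded_compose[OF b(1)] poly_bounded_mult poly_bounded_id)
    moreover have "\<exists>\<psi>\<in>sums_of (b' N) PR. sym_sum a = sym_sum \<psi>"
      if a: "mform K a" "sym_sum a \<in> sums_of N (T1 (Suc W) \<union> T2 (Suc (set_encode Z)))"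
      for a :: "(nat \<Rightarrow> 'v) \<Rightarrow> bit" and N
    proof -
      have "sym_sum a \<in> sums_of N (X \<union> T)"
        using a(2) by (rule sums_of_mono) (use T1_Suc in \<open>auto simp: T_def\<close>)
      then obtain F h where F: "F \<in> sums_of N X" and h: "h \<in> sums_of N T"
        and aFh: "sym_sum a = F + h" by (rule sums_of_split)
      have G: "\<exists>B. mform B g \<and> A \<inter> B = {}" if "g \<in> {g. mform (Z - I0) g}"
        for g :: "(nat \<Rightarrow> 'v) \<Rightarrow> bit"
        using that by (intro exI[of _ "Z - I0"]) (auto simp: A_def)
      obtain M x k where M: "M \<le> N"
        and k: "\<And>j. j < M \<Longrightarrow> k j \<in> sums_of N {g. mform (Z - I0) g}"
        and Fk: "F = (\<Sum>j<M. slice A (x j) F * k j)"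
        using slice_factorisation[OF F[unfolded X_def] G] by meson
      have k: "mform (Z - I0) (k j)" if "j < M" for j using k[OF that] by (rule mform_sums_of)
      \<comment> \<open>A slice of \<open>F\<close> is \<open>sym_sum\<close> of a slice of
        \<open>a\<close>, up to a slice of \<open>h\<close>. Thus \<open>F\<close> equals
        \<open>sym_sum g\<close> up to terms in \<open>T\<close>.\<close>
      define g where "g = (\<Sum>j<M. slice A (x j) a * k j)"
      have "slice A (x j) a * k j \<in> PR" if "j < M" for j
      proof (rule PR_I)
        show "mform A (slice A (x j) a)"
          by (rule mform_slice'[OF a(1)]) (use I0 pq in \<open>auto simp: A_def\<close>)
        have "K - A = Z - I0" by (auto simp: A_def)
        then show "mform (K - A) (k j)" using k[OF that] by simp
        show "A \<noteq> {}" "A \<subset> K" using I0 pq by (auto simp: A_def)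
      qed
      then have "g \<in> sums_of M PR"
        unfolding g_def by (intro sums_of_setsum) auto
      then have g: "g \<in> sums_of N PR" using M by (elim sums_of_mono) auto
      \<comment> \<open>\<open>A\<close> contains both \<open>p\<close> and \<open>q\<close>, so
        freezing the other variables commutes with the exchange.\<close>
      have slice_sym: "slice A y (sym_sum a) = sym_sum (slice A y a)" for y
      proof -
        have "slice A y (sw a) z = sw (slice A y a) z" for z
          unfolding slice_def sw_def
          by (rule mform_cong[OF a(1)]) (auto simp: A_def transpose_def)
        then have "slice A y (sw a) = sw (slice A y a)" by blast
        then show ?thesis by (simp only: sym_sum_def slice_add)
      qed
      have "sym_sum g = (\<Sum>j<M. sym_sum (slice A (x j) a) * k j)"
      proof -
        have "sym_sum (slice A (x j) a * k j) = sym_sum (slice A (x j) a) * k j" if "j < M" for j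
          using sw_eq[OF k[OF that]] by (simp add: sym_sum_def sw_mult distrib_right)
        moreover have "sym_sum (\<Sum>j<m. f j) = (\<Sum>j<m. sym_sum (f j))"
          for m and f :: "nat \<Rightarrow> (nat \<Rightarrow> 'v) \<Rightarrow> bit"
          by (induction m)
            (simp_all only: sym_sum_zero sym_sum_add lessThan_0 sum.empty sum.lessThan_Suc)
        ultimately show ?thesis unfolding g_def by simp
      qed
      moreover have "F = (\<Sum>j<M. sym_sum (slice A (x j) a) * k j) + (\<Sum>j<M. slice A (x j) h * k j)"
      proof -
        have "F = sym_sum a + h" unfolding aFh by (simp add: add.assoc)
        then have "slice A y F = sym_sum (slice A y a) + slice A y h" for y
          by (simp only: slice_add slice_sym)
        then show ?thesis by (subst Fk) (simp only: distrib_right sum.distrib)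
      qed
      ultimately have D: "sym_sum (a + g) = (\<Sum>j<M. slice A (x j) h * k j) + h"
        unfolding sym_sum_add aFh by (simp add: ac_simps)
      have "slice A (x j) h * k j \<in> sums_of N T" if "j < M" for j
        by (rule sums_of_image[OF h, of "\<lambda>t. slice A (x j) t * k j"])
          (simp_all only: slice_zero slice_add distrib_right mult_zero_left slice_T k[OF that])
      then have "sym_sum (a + g) \<in> sums_of (M * N + N) T"
        unfolding D by (intro sums_of_add sums_of_sum h)
      then have "sym_sum (a + g) \<in> sums_of (N * N + N) T"
        using M by (elim sums_of_mono) auto
      then obtain \<psi> where \<psi>: "\<psi> \<in> sums_of (b (N * N + N)) PR"
        "sym_sum (a + g) = sym_sum \<psi>"
        using b(2) mform_add[OF a(1) mform_sums_PR[OF g]] by blast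
      have "\<psi> + g \<in> sums_of (b' N) PR" unfolding b'_def by (rule sums_of_add[OF \<psi>(1) g])
      moreover have "sym_sum a = sym_sum (\<psi> + g)"
        unfolding sym_sum_add \<psi>(2)[symmetric] by (simp add: add.assoc)
      ultimately show ?thesis by blast
    qed
    ultimately show ?thesis by blast
  qed
qed

text \<open>The factor containing \<open>p\<close> is written first; whether it also contains
  \<open>q\<close> decides between \<open>T1\<close> and \<open>T2\<close>. No code exceeds that of
  \<open>Z\<close>.\<close>

lemma PR_subset: "PR \<subseteq> T1 (Suc (set_encode Z)) \<union> T2 (Suc (set_encode Z))"
proof
  fix t :: "(nat \<Rightarrow> 'a) \<Rightarrow> bit"
  assume "t \<in> PR"
  then obtain f g I where t: "t = f * g" "I \<noteq> {}" "I \<subset> K" "mform I f" "mform (K - I) g"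
    unfolding PR_def by blast
  have enc: "set_encode J < Suc (set_encode Z)" if "J \<subseteq> Z" for J
    using that finite_Z[of Z] by (simp add: less_Suc_eq_le set_encode_mono)
  have split: "f * g \<in> T1 (Suc (set_encode Z)) \<union> T2 (Suc (set_encode Z))"
    if "I \<noteq> {}" "I \<subset> K" "mform I f" "mform (K - I) g" "p \<in> I"
    for f g :: "(nat \<Rightarrow> 'a) \<Rightarrow> bit" and I
  proof (cases "q \<in> I")
    case True
    have "{p, q} \<union> (I - {p, q}) = I" "Z - (I - {p, q}) = K - I" using that True by auto
    then have "f * g \<in> T1 (Suc (set_encode Z))"
      using that True by (intro T1_I[of "I - {p, q}"] enc) auto
    then show ?thesis by blast
  next
    case False
    have "insert p (I - {p}) = I" "insert q (K - I - {q}) = K - I"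
      "Z - (I - {p}) - (K - I - {q}) = {}" using that False pq by auto
    moreover have "I - {p} \<subseteq> Z" "K - I - {q} \<subseteq> Z" "(I - {p}) \<inter> (K - I - {q}) = {}"
      using that False by auto
    ultimately have "f * (g * 1) \<in> T2 (Suc (set_encode Z))"
      using T2_I[of "I - {p}" f "K - I - {q}" g 1] enc that(3,4) mform_one by metis
    then show ?thesis by simp
  qed
  show "t \<in> T1 (Suc (set_encode Z)) \<union> T2 (Suc (set_encode Z))"
  proof (cases "p \<in> I")
    case True
    then show ?thesis unfolding t(1) using t by (intro split) auto
  next
    case False
    have "K - (K - I) = I" using t by auto
    then have "g * f \<in> T1 (Suc (set_encode Z)) \<union> T2 (Suc (set_encode Z))"
      using t False pq by (intro split[of "K - I"]) auto
    then show ?thesis unfolding t(1) by (simp only: mult.commute)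
  qed
qed

lemma low_rank_sym_sum:
  "\<exists>b. poly_bounded b \<and> (\<forall>(a :: (nat \<Rightarrow> 'v::ab_group_add) \<Rightarrow> bit) N. mform K a \<longrightarrow>
    sym_sum a \<in> sums_of N PR \<longrightarrow> (\<exists>\<psi>\<in>sums_of (b N) PR. sym_sum a = sym_sum \<psi>))"
  using eliminate_T1[of "Suc (set_encode Z)", where 'v = 'v]
  by (meson PR_subset order_refl sums_of_mono)

end

section \<open>Transfer between the two notions of multilinear form\<close>

text \<open>
  Working over the group of all functions \<^typ>\<open>nat \<Rightarrow> bit\<close>, of which only the first \<open>n\<close> values
  matter, makes all identities between forms hold without side conditions.
\<close>

definition lift_form :: "nat \<Rightarrow> nat set \<Rightarrow> form \<Rightarrow> (nat \<Rightarrow> nat \<Rightarrow> bit) \<Rightarrow> bit" where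
  "lift_form n I f y = f (restrict (\<lambda>i. vec n (y i)) I)"

text \<open>Filling up with 0 is additive also at indices from \<open>n\<close> on, where
  \<open>$\<close> carries no information.\<close>

definition lower_form :: "nat \<Rightarrow> ((nat \<Rightarrow> nat \<Rightarrow> bit) \<Rightarrow> bit) \<Rightarrow> form" where
  "lower_form n f x = f (\<lambda>i j. if j < n then x i $ j else 0)"

lemma tuples_carrier: "x \<in> tuples n I \<Longrightarrow> i \<in> I \<Longrightarrow> x i \<in> carrier_vec n"
  by (auto simp: tuples_def PiE_iff)

lemma mform_lift:
  assumes "multilinear_form n I f"
  shows "mform I (lift_form n I f)"
  unfolding mform_def
proof (intro conjI ballI allI impI)
  fix x :: "nat \<Rightarrow> nat \<Rightarrow> bit" and i and u v :: "nat \<Rightarrow> bit"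
  assume i: "i \<in> I"
  let ?x = "restrict (\<lambda>i. vec n (x i)) I"
  have upd: "restrict (\<lambda>j. vec n ((x(i := w)) j)) I = ?x(i := vec n w)" for w
    using i by (auto simp: restrict_def)
  have x: "?x \<in> tuples n I" by (simp add: tuples_def)
  have "vec n (u + v) = vec n u + vec n v" by auto
  then have "f (?x(i := vec n (u + v))) = f (?x(i := vec n u)) + f (?x(i := vec n v))"
    using assms x i unfolding multilinear_form_def by (metis vec_carrier)
  then show "lift_form n I f (x(i := u + v)) =
      lift_form n I f (x(i := u)) + lift_form n I f (x(i := v))"
    unfolding lift_form_def upd .
next
  fix x y :: "nat \<Rightarrow> nat \<Rightarrow> bit" assume "\<forall>i\<in>I. x i = y i"
  then have "restrict (\<lambda>i. vec n (x i)) I = restrict (\<lambda>i. vec n (y i)) I"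
    by (auto simp: restrict_def)
  then show "lift_form n I f x = lift_form n I f y" by (simp add: lift_form_def)
qed

lemma multilinear_lower:
  assumes f: "mform I f"
  shows "multilinear_form n I (lower_form n f)"
  unfolding multilinear_form_def
proof (intro ballI allI conjI)
  fix x :: "nat \<Rightarrow> bit vec" and i and u v :: "bit vec" and c
  assume i: "i \<in> I" and u: "u \<in> carrier_vec n"
  let ?e = "\<lambda>w j. if j < n then w $ j else (0::bit)"
  let ?x = "\<lambda>i. ?e (x i)"
  have upd: "lower_form n f (x(i := w)) = f (?x(i := ?e w))" for w
  proof -
    have "(\<lambda>k j. if j < n then (x(i := w)) k $ j else 0) = ?x(i := ?e w)"
      by (auto simp: fun_eq_iff)
    then show ?thesis unfolding lower_form_def by simp
  qed
  show "lower_form n f (x(i := u + v)) = lower_form n f (x(i := u)) + lower_form n f (x(i := v))"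
    if v: "v \<in> carrier_vec n"
  proof -
    have "?e (u + v) = ?e u + ?e v" using u v by (auto simp: fun_eq_iff)
    then show ?thesis unfolding upd using mform_add_at[OF f i] by simp
  qed
  show "lower_form n f (x(i := c \<cdot>\<^sub>v u)) = c * lower_form n f (x(i := u))"
  proof (cases "c = 0")
    case True
    have "f (?x(i := 0)) = 0" using mform_add_at[OF f i, of ?x 0 0] by simp
    moreover have "?e (c \<cdot>\<^sub>v u) = 0" using u True by (auto simp: fun_eq_iff)
    ultimately show ?thesis unfolding upd using True by simp
  next
    case False
    then have "c = 1" by simp
    then show ?thesis using u by simp
  qed
qed

lemma lower_lift:
  assumes "x \<in> tuples n I"
  shows "lower_form n (lift_form n I f) x = f x"
proof -
  have "restrict (\<lambda>i. vec n (\<lambda>j. if j < n then x i $ j else 0)) I = x"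
  proof
    fix i
    show "restrict (\<lambda>i. vec n (\<lambda>j. if j < n then x i $ j else 0)) I i = x i"
    proof (cases "i \<in> I")
      case True
      then show ?thesis using tuples_carrier[OF assms True] by auto
    qed (use assms in \<open>auto simp: tuples_def PiE_iff extensional_def\<close>)
  qed
  then show ?thesis by (simp add: lower_form_def lift_form_def)
qed

lemma lower_restrict: "mform I f \<Longrightarrow> lower_form n f (restrict x I) = lower_form n f x"
  unfolding lower_form_def by (rule mform_cong[of I f]) auto

lemma lower_add: "lower_form n (f + g) x = lower_form n f x + lower_form n g x"
  by (simp only: lower_form_def plus_fun_apply)

lemma partition_decomposition_cong:
  assumes "\<And>x. x \<in> tuples n {1..k} \<Longrightarrow> f x = g x"
  shows "partition_decomposition n k f m \<longleftrightarrow> partition_decomposition n k g m"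
  using assms by (simp add: partition_decomposition_def)

section \<open>Existence of decompositions and the exponential bound\<close>

lemma linear_expansion:
  fixes g :: "bit vec \<Rightarrow> bit"
  assumes add: "\<And>u v. u \<in> carrier_vec n \<Longrightarrow> v \<in> carrier_vec n \<Longrightarrow> g (u + v) = g u + g v"
    and smult: "\<And>c u. u \<in> carrier_vec n \<Longrightarrow> g (c \<cdot>\<^sub>v u) = c * g u"
    and v: "v \<in> carrier_vec n"
  shows "g v = (\<Sum>i<n. v $ i * g (unit_vec n i))"
proof -
  \<comment> \<open>Induction on the number \<open>m\<close> of coordinates that are kept, the
    others being set to 0.\<close>
  have "g (vec n (\<lambda>j. if j < m then v $ j else 0)) = (\<Sum>i<m. v $ i * g (unit_vec n i))"
    if "m \<le> n" for m
    using that
  proof (induction m)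
    case 0
    have "vec n (\<lambda>j. if j < 0 then v $ j else 0) = 0 \<cdot>\<^sub>v 0\<^sub>v n" by auto
    then show ?case using smult[of "0\<^sub>v n" 0] by simp
  next
    case (Suc m)
    have "vec n (\<lambda>j. if j < Suc m then v $ j else 0) =
        vec n (\<lambda>j. if j < m then v $ j else 0) + v $ m \<cdot>\<^sub>v unit_vec n m"
      using Suc.prems by (intro eq_vecI) (auto simp: less_Suc_eq)
    then show ?case using Suc by (simp only: add smult vec_carrier unit_vec_carrier
      smult_carrier_vec sum.lessThan_Suc Suc_leD)
  qed
  moreover have "vec n (\<lambda>j. if j < n then v $ j else 0) = v" using v by auto
  ultimately show ?thesis by (metis order_refl)
qed

text \<open>This makes the minimum in \<open>prank\<close> attained. Terms are numbered from 1 and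
  coordinates from 0, hence \<open>i - 1\<close>; \<open>k \<ge> 2\<close> makes \<open>{1}\<close>
  a proper subset.\<close>

lemma partition_decomposition_exists:
  assumes f: "multilinear_form n {1..k} f" and k: "k \<ge> 2"
  shows "partition_decomposition n k f n"
proof -
  let ?\<beta> = "\<lambda>i (x :: nat \<Rightarrow> bit vec). x 1 $ (i - 1)"
  let ?\<gamma> = "\<lambda>i x. f (x(1 := unit_vec n (i - 1)))"
  have ins: "x(1 := v) \<in> tuples n {1..k}"
    if "x \<in> tuples n ({1..k} - {1})" "v \<in> carrier_vec n" for x v
    using that k by (fastforce simp: tuples_def PiE_iff extensional_def)
  have \<beta>: "multilinear_form n {1} (?\<beta> i)" if "i \<in> {1..n}" for i
    unfolding multilinear_form_def
  proof (intro ballI allI conjI)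
    fix x :: "nat \<Rightarrow> bit vec" and j and u v :: "bit vec" and c
    assume j: "j \<in> {1::nat}" and u: "u \<in> carrier_vec n"
    have i: "i - 1 < n" using that by auto
    show "?\<beta> i (x(j := u + v)) = ?\<beta> i (x(j := u)) + ?\<beta> i (x(j := v))" if "v \<in> carrier_vec n"
      using i j u that by (simp only: singleton_iff fun_upd_same index_add_vec carrier_vecD)
    show "?\<beta> i (x(j := c \<cdot>\<^sub>v u)) = c * ?\<beta> i (x(j := u))"
      using i j u by (simp only: singleton_iff fun_upd_same index_smult_vec carrier_vecD)
  qed
  have \<gamma>: "multilinear_form n ({1..k} - {1}) (?\<gamma> i)" if "i \<in> {1..n}" for i
    unfolding multilinear_form_def
  proof (intro ballI allI conjI)
    fix x j and u v :: "bit vec" and c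
    assume x: "x \<in> tuples n ({1..k} - {1})" and j: "j \<in> {1..k} - {1}" and u: "u \<in> carrier_vec n"
    have comm: "(x(j := w))(1 := unit_vec n (i - 1)) = (x(1 := unit_vec n (i - 1)))(j := w)" for w
      using j by auto
    have "x(1 := unit_vec n (i - 1)) \<in> tuples n {1..k}" "j \<in> {1..k}"
      using ins[OF x] j by auto
    then show "v \<in> carrier_vec n \<Longrightarrow> ?\<gamma> i (x(j := u + v)) = ?\<gamma> i (x(j := u)) + ?\<gamma> i (x(j := v))"
      "?\<gamma> i (x(j := c \<cdot>\<^sub>v u)) = c * ?\<gamma> i (x(j := u))"
      using f u unfolding comm multilinear_form_def by blast+
  qed
  have expand: "f x = (\<Sum>i=1..n. ?\<beta> i (restrict x {1}) * ?\<gamma> i (restrict x ({1..k} - {1})))"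
    if x: "x \<in> tuples n {1..k}" for x
  proof -
    have one: "1 \<in> {1..k}" using k by auto
    have "f (x(1 := x 1)) = (\<Sum>i<n. x 1 $ i * f (x(1 := unit_vec n i)))"
      by (rule linear_expansion[where g = "\<lambda>v. f (x(1 := v))"])
        (use f x one tuples_carrier[OF x one] in \<open>auto simp: multilinear_form_def\<close>)
    also have "\<dots> = (\<Sum>i=1..n. x 1 $ (i - 1) * f (x(1 := unit_vec n (i - 1))))"
      by (rule sum.reindex_bij_witness[of _ "\<lambda>i. i - 1" Suc]) auto
    also have "\<dots> = (\<Sum>i=1..n. ?\<beta> i (restrict x {1}) * ?\<gamma> i (restrict x ({1..k} - {1})))"
    proof -
      have "(restrict x ({1..k} - {1}))(1 := v) = x(1 := v)" for v
        using x by (fastforce simp: tuples_def PiE_iff extensional_def)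
      then show ?thesis by simp
    qed
    finally show ?thesis by simp
  qed
  have "2 \<in> {1..k}" "2 \<notin> {1::nat}" using k by auto
  then have "{1} \<noteq> {1..k}" by metis
  moreover have "{1} \<subseteq> {1..k}" using k by simp
  ultimately have "{1} \<subset> {1..k}" by (intro psubsetI)
  then show ?thesis
    unfolding partition_decomposition_def
    by (intro exI[of _ "\<lambda>_. {1}"] exI[of _ ?\<beta>] exI[of _ ?\<gamma>] conjI ballI insert_not_empty
        \<beta> \<gamma> expand)
qed

text \<open>For \<open>r > 0\<close>, the inequality \<open>x \<le> exp x\<close> gives
  \<open>c * r ^ c \<le> exp (c * r) * exp r ^ c\<close>, so \<open>A = 2 * c\<close> works.\<close>

lemma poly_bounded_exp:
  assumes "poly_bounded b"
  shows "\<exists>A>0. \<forall>r. real (b r) \<le> exp (A * real r)"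
proof -
  obtain c where c: "c > 0" "\<And>N. b N \<le> c * N ^ c" using assms by (auto simp: poly_bounded_def)
  have "real (b r) \<le> exp (2 * real c * real r)" for r
  proof (cases "r = 0")
    case True
    then show ?thesis using c(2)[of 0] c(1) by (simp add: zero_power)
  next
    case False
    have le_exp: "x \<le> exp x" for x :: real using exp_ge_add_one_self[of x] by linarith
    have "real (b r) \<le> real c * real r ^ c"
      using c(2)[of r] by (metis of_nat_le_iff of_nat_mult of_nat_power)
    also have "\<dots> \<le> exp (real c * real r) * exp (real r) ^ c"
    proof (intro mult_mono power_mono le_exp)
      have "real c * 1 \<le> real c * real r" using False by (intro mult_left_mono) auto
      then have "real c \<le> real c * real r" by simp
      also have "\<dots> \<le> exp (real c * real r)" by (rule le_exp)
      finally show "real c \<le> exp (real c * real r)" .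
    qed auto
    also have "\<dots> = exp (2 * real c * real r)"
      by (simp add: exp_of_nat_mult[symmetric] exp_add[symmetric])
    finally show ?thesis .
  qed
  then show ?thesis using c(1) by (intro exI[of _ "2 * real c"]) auto
qed

section \<open>Assembly for the first two variables\<close>

theorem theorem7:
  fixes k :: nat
  assumes "k \<ge> 2"
  shows "\<exists>A::real. A > 0 \<and> (\<exists>t::nat. \<forall>(n::nat) (r::nat) (\<alpha>::form).
    multilinear_form n {1..k} \<alpha> \<and>
    prank n k (\<lambda>x. \<alpha> x + permute_form \<alpha> (Transposition.transpose 1 2) x) \<le> r \<longrightarrow>
    (\<exists>\<alpha>'::form. multilinear_form n {1..k} \<alpha>' \<and> symmetric_in n k {1..2} \<alpha>' \<and>
      real (prank n k (\<lambda>x. \<alpha> x + \<alpha>' x)) \<le> (exp ^^ t) (A * real r)))"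
proof -
  interpret two_slots 1 2 "{1..k}" by standard (use assms in auto)
  let ?\<tau> = "Transposition.transpose 1 2 :: nat \<Rightarrow> nat"
  obtain b where b: "poly_bounded b" "\<And>(a :: (nat \<Rightarrow> nat \<Rightarrow> bit) \<Rightarrow> bit) N. mform {1..k} a \<Longrightarrow>
      sym_sum a \<in> sums_of N PR \<Longrightarrow> \<exists>\<psi>\<in>sums_of (b N) PR. sym_sum a = sym_sum \<psi>"
    using low_rank_sym_sum by blast
  obtain A where A: "A > 0" "\<And>r. real (b r) \<le> exp (A * real r)"
    using poly_bounded_exp[OF b(1)] by blast
  have to_sums: "lift_form n {1..k} f \<in> sums_of m PR" if pd: "partition_decomposition n k f m" for n f m
  proof -
    obtain I \<beta> \<gamma> where d: "\<forall>i\<in>{1..m}. I i \<noteq> {} \<and> I i \<subset> {1..k} \<and>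
        multilinear_form n (I i) (\<beta> i) \<and> multilinear_form n ({1..k} - I i) (\<gamma> i)"
      and f: "\<forall>x\<in>tuples n {1..k}.
        f x = (\<Sum>i=1..m. \<beta> i (restrict x (I i)) * \<gamma> i (restrict x ({1..k} - I i)))"
      using pd unfolding partition_decomposition_def by (elim exE conjE) (rule that)
    have sum_app: "(\<Sum>i\<in>X. h i) x = (\<Sum>i\<in>X. h i x)"
      for h :: "nat \<Rightarrow> (nat \<Rightarrow> nat \<Rightarrow> bit) \<Rightarrow> bit" and X x
      by (induction X rule: infinite_finite_induct) auto
    have "lift_form n {1..k} f y =
        (\<Sum>i=1..m. lift_form n (I i) (\<beta> i) * lift_form n ({1..k} - I i) (\<gamma> i)) y" for y
    proof -
      let ?y = "restrict (\<lambda>i. vec n (y i)) {1..k}"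
      have "?y \<in> tuples n {1..k}" by (simp add: tuples_def)
      then have "lift_form n {1..k} f y =
          (\<Sum>i=1..m. \<beta> i (restrict ?y (I i)) * \<gamma> i (restrict ?y ({1..k} - I i)))"
        unfolding lift_form_def by (rule bspec[OF f])
      also have "\<dots> = (\<Sum>i=1..m. lift_form n (I i) (\<beta> i) y * lift_form n ({1..k} - I i) (\<gamma> i) y)"
      proof (intro sum.cong refl)
        fix i assume "i \<in> {1..m}"
        then have "{1..k} \<inter> I i = I i" "{1..k} \<inter> ({1..k} - I i) = {1..k} - I i" using d by blast+
        then show "\<beta> i (restrict ?y (I i)) * \<gamma> i (restrict ?y ({1..k} - I i)) =
            lift_form n (I i) (\<beta> i) y * lift_form n ({1..k} - I i) (\<gamma> i) y"
          by (simp add: lift_form_def restrict_restrict)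
      qed
      finally show ?thesis by (simp only: sum_app times_fun_apply)
    qed
    then have "lift_form n {1..k} f =
        (\<Sum>i=1..m. lift_form n (I i) (\<beta> i) * lift_form n ({1..k} - I i) (\<gamma> i))" by blast
    moreover have "\<dots> \<in> sums_of m PR"
    proof (rule sums_of_setsum)
      fix i assume "i \<in> {1..m}"
      then show "lift_form n (I i) (\<beta> i) * lift_form n ({1..k} - I i) (\<gamma> i) \<in> PR"
        using d by (intro PR_I[OF mform_lift mform_lift]) auto
    qed auto
    ultimately show ?thesis by (simp only:)
  qed
  \<comment> \<open>Agreement on tuples is enough, since \<open>prank\<close> reads only the values
    there.\<close>
  have from_sums: "prank n k g \<le> N"
    if f: "f \<in> sums_of N PR" and g: "\<And>x. x \<in> tuples n {1..k} \<Longrightarrow> g x = lower_form n f x"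
    for n f g N
  proof -
    obtain ts where ts: "f = sum_list ts" "length ts \<le> N" "set ts \<subseteq> PR"
      using f by (rule sums_ofE)
    have "\<forall>t :: (nat \<Rightarrow> nat \<Rightarrow> bit) \<Rightarrow> bit. \<exists>I u v. t \<in> PR \<longrightarrow>
        t = u * v \<and> I \<noteq> {} \<and> I \<subset> {1..k} \<and> mform I u \<and> mform ({1..k} - I) v"
      unfolding PR_def by blast
    then obtain I u v where "\<forall>t :: (nat \<Rightarrow> nat \<Rightarrow> bit) \<Rightarrow> bit. t \<in> PR \<longrightarrow> t = u t * v t \<and> I t \<noteq> {} \<and> I t \<subset> {1..k} \<and>
        mform (I t) (u t) \<and> mform ({1..k} - I t) (v t)"
      unfolding choice_iff by (elim exE) (rule that)
    then have d: "t = u t * v t \<and> I t \<noteq> {} \<and> I t \<subset> {1..k} \<and>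
        mform (I t) (u t) \<and> mform ({1..k} - I t) (v t)" if "t \<in> PR" for t using that by blast
    have lower_sum: "lower_form n (sum_list ts) x = (\<Sum>i=1..length ts. lower_form n (ts ! (i - 1)) x)"
      for ts x
    proof -
      have "lower_form n (sum_list ts) x = sum_list (map (\<lambda>t. lower_form n t x) ts)"
        by (induction ts) (simp_all add: lower_add lower_form_def)
      also have "\<dots> = (\<Sum>i<length ts. lower_form n (ts ! i) x)"
        by (simp add: sum_list_sum_nth lessThan_atLeast0)
      also have "\<dots> = (\<Sum>i=1..length ts. lower_form n (ts ! (i - 1)) x)"
        by (rule sum.reindex_bij_witness[of _ "\<lambda>i. i - 1" Suc]) auto
      finally show ?thesis .
    qed
    have PR: "ts ! (i - 1) \<in> PR" if "i \<in> {1..length ts}" for i using that ts(3) by fastforce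
    define J where "J i = I (ts ! (i - 1))" for i
    define \<beta> where "\<beta> i = lower_form n (u (ts ! (i - 1)))" for i
    define \<gamma> where "\<gamma> i = lower_form n (v (ts ! (i - 1)))" for i
    have forms: "J i \<noteq> {} \<and> J i \<subset> {1..k} \<and>
        multilinear_form n (J i) (\<beta> i) \<and> multilinear_form n ({1..k} - J i) (\<gamma> i)"
      if "i \<in> {1..length ts}" for i
      unfolding J_def \<beta>_def \<gamma>_def
      using d[OF PR[OF that]] multilinear_lower by (intro conjI) auto
    have expand: "lower_form n f x =
        (\<Sum>i=1..length ts. \<beta> i (restrict x (J i)) * \<gamma> i (restrict x ({1..k} - J i)))" for x
      unfolding ts(1) lower_sum
    proof (intro sum.cong refl)
      fix i assume i: "i \<in> {1..length ts}"
      let ?t = "ts ! (i - 1)"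
      have t: "?t = u ?t * v ?t" and uv: "mform (I ?t) (u ?t)" "mform ({1..k} - I ?t) (v ?t)"
        using d[OF PR[OF i]] by auto
      have "lower_form n ?t x = lower_form n (u ?t) x * lower_form n (v ?t) x"
        by (subst t) (simp only: lower_form_def times_fun_apply)
      then show "lower_form n ?t x = \<beta> i (restrict x (J i)) * \<gamma> i (restrict x ({1..k} - J i))"
        unfolding J_def \<beta>_def \<gamma>_def by (simp only: lower_restrict uv)
    qed
    have "partition_decomposition n k (lower_form n f) (length ts)"
      unfolding partition_decomposition_def
      by (rule exI[of _ J], rule exI[of _ \<beta>], rule exI[of _ \<gamma>])
        (rule conjI[OF ballI[OF forms] ballI[OF expand]])
    then have "partition_decomposition n k g (length ts)"
      using partition_decomposition_cong[of n k g "lower_form n f"] g by blast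
    then have "prank n k g \<le> length ts" unfolding prank_def by (rule Least_le)
    then show ?thesis using ts(2) by simp
  qed
  have tau_in: "?\<tau> i \<in> {1..k} \<longleftrightarrow> i \<in> {1..k}" for i
    using assms by (auto simp: transpose_def)
  have lower_sw: "permute_form (lower_form n f) ?\<tau> x = lower_form n (sw f) x" for n f x
    by (simp only: permute_form_def lower_form_def sw_def comp_def inv_transpose_eq)
  have lift_sw: "lift_form n {1..k} (permute_form f ?\<tau>) = sw (lift_form n {1..k} f)" for n f
  proof
    fix y :: "nat \<Rightarrow> nat \<Rightarrow> bit"
    have "(\<lambda>i. restrict (\<lambda>i. vec n (y i)) {1..k} (?\<tau> i)) =
        restrict (\<lambda>i. vec n ((y \<circ> ?\<tau>) i)) {1..k}"
      using tau_in by (auto simp: restrict_def)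
    then show "lift_form n {1..k} (permute_form f ?\<tau>) y = sw (lift_form n {1..k} f) y"
      by (simp only: permute_form_def lift_form_def sw_def inv_transpose_eq)
  qed
  have main: "\<exists>\<alpha>'. multilinear_form n {1..k} \<alpha>' \<and> symmetric_in n k {1..2} \<alpha>' \<and>
      real (prank n k (\<lambda>x. \<alpha> x + \<alpha>' x)) \<le> exp (A * real r)"
    if \<alpha>: "multilinear_form n {1..k} \<alpha>"
      and r: "prank n k (\<lambda>x. \<alpha> x + permute_form \<alpha> ?\<tau> x) \<le> r" for n r \<alpha>
  proof -
    define \<phi> where "\<phi> x = \<alpha> x + permute_form \<alpha> ?\<tau> x" for x
    define a where "a = lift_form n {1..k} \<alpha>"
    have a: "mform {1..k} a" unfolding a_def by (rule mform_lift[OF \<alpha>])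
    have \<phi>_lift: "lift_form n {1..k} \<phi> = sym_sum a"
    proof -
      have "lift_form n {1..k} \<phi> = a + lift_form n {1..k} (permute_form \<alpha> ?\<tau>)"
        unfolding a_def by (rule ext) (simp only: lift_form_def \<phi>_def plus_fun_apply)
      then show ?thesis unfolding lift_sw sym_sum_def a_def .
    qed
    \<comment> \<open>Lowering \<open>sym_sum a\<close> gives a multilinear form that agrees with
      \<phi> on tuples, so \<phi> has a decomposition and its rank is attained.\<close>
    have "mform {1..k} (sym_sum a)"
      unfolding sym_sum_def by (intro mform_add a mform_sw[OF a]) (use assms in auto)
    then have "multilinear_form n {1..k} (lower_form n (sym_sum a))" by (rule multilinear_lower)
    then have "partition_decomposition n k (lower_form n (sym_sum a)) n"
      using assms by (rule partition_decomposition_exists)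
    then have "partition_decomposition n k \<phi> n"
      using partition_decomposition_cong[of n k \<phi> "lower_form n (sym_sum a)"]
        lower_lift[of _ n "{1..k}" \<phi>] unfolding \<phi>_lift by simp
    then have "partition_decomposition n k \<phi> (prank n k \<phi>)" unfolding prank_def by (rule LeastI)
    then have "sym_sum a \<in> sums_of (prank n k \<phi>) PR" using to_sums \<phi>_lift by metis
    then have "sym_sum a \<in> sums_of r PR"
      using r unfolding \<phi>_def[abs_def] by (elim sums_of_mono) auto
    then obtain \<psi> where \<psi>: "\<psi> \<in> sums_of (b r) PR" "sym_sum a = sym_sum \<psi>" using b(2)[OF a] by blast
    \<comment> \<open>The form \<alpha> + \<psi> is symmetric, as \<open>sym_sum\<close> of it is
      \<phi> + \<phi> = 0, and it differs from \<alpha> by \<psi>.\<close>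
    define \<alpha>' where "\<alpha>' = lower_form n (a + \<psi>)"
    have "multilinear_form n {1..k} \<alpha>'"
      unfolding \<alpha>'_def by (intro multilinear_lower mform_add a mform_sums_PR[OF \<psi>(1)])
    moreover have "symmetric_in n k {1..2} \<alpha>'"
      unfolding symmetric_in_def
    proof (intro allI impI ballI)
      fix \<pi> :: "nat \<Rightarrow> nat" and x
      assume "\<pi> permutes {1..2}"
      moreover have "{1..2} = {1, 2::nat}" by auto
      ultimately have "\<pi> = id \<or> \<pi> = ?\<tau>" using permutes_doubleton_iff by metis
      then show "permute_form \<alpha>' \<pi> x = \<alpha>' x"
      proof
        assume "\<pi> = id"
        then show ?thesis by (simp add: permute_form_def)
      next
        assume \<pi>: "\<pi> = ?\<tau>"
        have "(a + \<psi>) + sw (a + \<psi>) = 0"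
          unfolding sym_sum_def[symmetric] sym_sum_add \<psi>(2) by (rule bit_fun_add_self)
        then have "sw (a + \<psi>) = a + \<psi>" by (metis add.right_neutral bit_fun_add_cancel)
        then show ?thesis unfolding \<pi> \<alpha>'_def lower_sw by simp
      qed
    qed
    moreover have "prank n k (\<lambda>x. \<alpha> x + \<alpha>' x) \<le> b r"
    proof (rule from_sums[OF \<psi>(1)])
      fix x assume x: "x \<in> tuples n {1..k}"
      have "\<alpha> x = lower_form n a x" unfolding a_def using lower_lift[OF x] by simp
      then show "\<alpha> x + \<alpha>' x = lower_form n \<psi> x"
        unfolding \<alpha>'_def lower_add by (simp only: add.assoc[symmetric]) simp
    qed
    ultimately show ?thesis using A(2)[of r] by (meson of_nat_le_iff order_trans)
  qed
  \<comment> \<open>The polynomial bound lies below a single exponential, so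
    \<open>t = 1\<close>.\<close>
  have one: "(exp ^^ 1) (A * real r) = exp (A * real r)" for r by simp
  show ?thesis
    by (rule exI[of _ A], intro conjI[OF A(1)], rule exI[of _ 1], intro allI impI, elim conjE)
      (simp only: one main)
qed

end
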